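(* Let $\mathfrak{g}$ be a Lie algebra over a field $k$, let $\bigotimes\mathfrak{g}=\bigoplus_{n\geq 0}\mathfrak{g}^{\otimes n}$ be its tensor algebra, and let $\mathfrak{U}(\mathfrak{g})$ be the associative algebra obtained as the quotient of $\bigotimes\mathfrak{g}$ by the two-sided ideal generated by all elements $a\otimes b-b\otimes a-[a,b]$ with $a,b\in\mathfrak{g}$. Write $ab\cdots d\in\mathfrak{U}(\mathfrak{g})$ for the class of $a\otimes b\otimes\cdots\otimes d$. Pick a basis of $\mathfrak{g}$ as a vector space over $k$, equipped with a total order $\leq$. Then every element of $\mathfrak{U}(\mathfrak{g})$ can be written, in one and only one way, as a finite $k$-linear combination of elements in canonical form. That is, the family of elements $x_1x_2\cdots x_n\in\mathfrak{U}(\mathfrak{g})$, indexed by all $n\geq 0$ and all finite sequences $(x_1,\ldots,x_n)$ of basis elements with $x_1\leq x_2\leq\cdots\leq x_n$, is a basis of $\mathfrak{U}(\mathfrak{g})$ as a vector space over $k$.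
   Context: An element $ab\cdots d\in\mathfrak{U}(\mathfrak{g})$ is said to be in canonical form (with respect to the chosen ordered basis of $\mathfrak{g}$) if $a,b,\ldots,d$ are elements of the chosen basis and $a\leq b\leq\cdots\leq d$ in the chosen ordering; repetitions are allowed, and the empty product ($n=0$), equal to $1\in\mathfrak{U}(\mathfrak{g})$, is included. Distinct weakly increasing sequences of basis elements are regarded as indexing distinct canonical forms. *)

theory Defs
  imports
    "HOL-Library.Poly_Mapping"
    "HOL-Library.Set_Algebras"
    "HOL-Algebra.QuotRing"
    "Jordan_Normal_Form.VS_Connect"
begin

locale lie_algebra = vector_space scale
  for scale :: "'k::field \<Rightarrow> 'g::ab_group_add \<Rightarrow> 'g" +
  fixes bracket :: "'g \<Rightarrow> 'g \<Rightarrow> 'g"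
  assumes linear_right: "Vector_Spaces.linear scale scale (\<lambda>y. bracket x y)"
    and linear_left: "Vector_Spaces.linear scale scale (\<lambda>x. bracket x y)"
    and alternating: "bracket x x = 0"
    and jacobi: "bracket x (bracket y z) + bracket y (bracket z x) + bracket z (bracket x y) = 0"

text \<open>Words form a monoid under concatenation, so that \<open>'g list \<Rightarrow>\<^sub>0 'k\<close>
  is the vector space with basis the words in \<open>'g\<close>, and its multiplication is the bilinear
  extension of concatenation.\<close>

instantiation list :: (type) monoid_add
begin

definition zero_list :: "'a list" where "zero_list = []"

definition plus_list :: "'a list \<Rightarrow> 'a list \<Rightarrow> 'a list" where "plus_list xs ys = xs @ ys"

instance
  by standard (simp_all add: zero_list_def plus_list_def)

end

definition word_scale :: "'k::field \<Rightarrow> ('g list \<Rightarrow>\<^sub>0 'k) \<Rightarrow> ('g list \<Rightarrow>\<^sub>0 'k)" where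
  "word_scale c p = Poly_Mapping.map (\<lambda>x. c * x) p"

lemma lookup_word_scale: "Poly_Mapping.lookup (word_scale c p) w = c * Poly_Mapping.lookup p w"
  by (simp add: word_scale_def Poly_Mapping.map.rep_eq "when_def")

lemma vector_space_word_scale:
  "vector_space (word_scale :: 'k::field \<Rightarrow> ('g list \<Rightarrow>\<^sub>0 'k) \<Rightarrow> ('g list \<Rightarrow>\<^sub>0 'k))"
  by unfold_locales
    (rule poly_mapping_eqI, simp add: lookup_word_scale lookup_add algebra_simps)+

text \<open>The tensor power \<open>g^{\<otimes>n}\<close> is the vector space with basis \<open>g^n\<close>, modulo the subspace
  \<open>multilinear_relations scale n\<close>; its elements are the cosets of that subspace.\<close>

definition multilinear_relations ::
    "('k::field \<Rightarrow> 'g::ab_group_add \<Rightarrow> 'g) \<Rightarrow> nat \<Rightarrow> ('g list \<Rightarrow>\<^sub>0 'k) set" where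
  "multilinear_relations scale n = Modules.module.span word_scale
    ({Poly_Mapping.single (u @ [a + b] @ v) 1
        - Poly_Mapping.single (u @ [a] @ v) 1 - Poly_Mapping.single (u @ [b] @ v) 1
      | u v a b. length u + 1 + length v = n} \<union>
     {Poly_Mapping.single (u @ [scale c a] @ v) 1 - word_scale c (Poly_Mapping.single (u @ [a] @ v) 1)
      | u v c a. length u + 1 + length v = n})"

definition tensor_power ::
    "('k::field \<Rightarrow> 'g::ab_group_add \<Rightarrow> 'g) \<Rightarrow> nat \<Rightarrow> ('g list \<Rightarrow>\<^sub>0 'k) set set" where
  "tensor_power scale n =
    {p +o multilinear_relations scale n | p. \<forall>w \<in> Poly_Mapping.keys p. length w = n}"

text \<open>The sums and products of cosets below are those of Set_Algebras, that is, elementwise.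
  The elementwise sum of two cosets is a coset; an elementwise product or scalar multiple
  only becomes a coset after adding the subspace of relations.\<close>

definition tensor_algebra ::
    "('k::field \<Rightarrow> 'g::ab_group_add \<Rightarrow> 'g) \<Rightarrow> ('k, nat \<Rightarrow> ('g list \<Rightarrow>\<^sub>0 'k) set) module" where
  "tensor_algebra scale =
    \<lparr>carrier = {t. (\<forall>n. t n \<in> tensor_power scale n) \<and>
                   finite {n. t n \<noteq> multilinear_relations scale n}},
     mult = (\<lambda>s t n. \<Sum>i\<le>n. s i * t (n - i) + multilinear_relations scale n),
     one = (\<lambda>n. (if n = 0 then 1 else 0) +o multilinear_relations scale n),
     zero = (\<lambda>n. multilinear_relations scale n),
     add = (\<lambda>s t n. s n + t n),
     smult = (\<lambda>c t n. word_scale c ` t n + multilinear_relations scale n)\<rparr>"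

text \<open>\<open>pure_tensor scale [a, b, \<dots>, d]\<close> is \<open>a \<otimes> b \<otimes> \<dots> \<otimes> d\<close>.\<close>

definition pure_tensor ::
    "('k::field \<Rightarrow> 'g::ab_group_add \<Rightarrow> 'g) \<Rightarrow> 'g list \<Rightarrow> nat \<Rightarrow> ('g list \<Rightarrow>\<^sub>0 'k) set" where
  "pure_tensor scale xs = (\<lambda>n.
    (if n = length xs then Poly_Mapping.single xs 1 else 0) +o multilinear_relations scale n)"

definition lie_ideal ::
    "('k::field \<Rightarrow> 'g::ab_group_add \<Rightarrow> 'g) \<Rightarrow> ('g \<Rightarrow> 'g \<Rightarrow> 'g)
      \<Rightarrow> (nat \<Rightarrow> ('g list \<Rightarrow>\<^sub>0 'k) set) set" where
  "lie_ideal scale bracket = genideal (tensor_algebra scale)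
    {pure_tensor scale [a, b] \<ominus>\<^bsub>tensor_algebra scale\<^esub> pure_tensor scale [b, a]
       \<ominus>\<^bsub>tensor_algebra scale\<^esub> pure_tensor scale [bracket a b] | a b. True}"

text \<open>\<open>FactRing\<close> only yields a ring; the scalar multiplication of the quotient
  is defined by the same pattern as the library's \<open>rcoset_mult\<close>.\<close>

definition enveloping_algebra ::
    "('k::field \<Rightarrow> 'g::ab_group_add \<Rightarrow> 'g) \<Rightarrow> ('g \<Rightarrow> 'g \<Rightarrow> 'g)
      \<Rightarrow> ('k, (nat \<Rightarrow> ('g list \<Rightarrow>\<^sub>0 'k) set) set) module" where
  "enveloping_algebra scale bracket =
    ring.extend (tensor_algebra scale Quot lie_ideal scale bracket)
      (module.fields (\<lambda>c X. \<Union>t\<in>X.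
        lie_ideal scale bracket +>\<^bsub>tensor_algebra scale\<^esub> (c \<odot>\<^bsub>tensor_algebra scale\<^esub> t)))"

definition word_class ::
    "('k::field \<Rightarrow> 'g::ab_group_add \<Rightarrow> 'g) \<Rightarrow> ('g \<Rightarrow> 'g \<Rightarrow> 'g)
      \<Rightarrow> 'g list \<Rightarrow> (nat \<Rightarrow> ('g list \<Rightarrow>\<^sub>0 'k) set) set" where
  "word_class scale bracket xs =
    lie_ideal scale bracket +>\<^bsub>tensor_algebra scale\<^esub> pure_tensor scale xs"

definition canonical_words :: "'g set \<Rightarrow> 'g rel \<Rightarrow> 'g list set" where
  "canonical_words B r = {xs. set xs \<subseteq> B \<and> sorted_wrt (\<lambda>x y. (x, y) \<in> r) xs}"

end

theory Submission
  imports Defs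
begin

text \<open>
  The enveloping algebra is the algebra of words in \<open>g\<close> modulo the span of all relators
  \<open>u \<rho> v\<close>, where \<open>\<rho>\<close> is a linearity relator or some \<open>ab - ba - [a,b]\<close>. A retraction of the
  algebra of words onto the span of the canonical words whose kernel is exactly this subspace
  therefore gives existence and uniqueness at once.

  Following Jacobson, the retraction expands every letter in the basis and then sorts: a word
  \<open>u x y v\<close> with \<open>x > y\<close> is replaced by \<open>u y x v + u [x,y] v\<close>, where the descent is
  chosen arbitrarily. That the choice does not matter is shown by induction on the length and the
  number of inversions: two disjoint descents commute, and two overlapping ones, in \<open>x > y > z\<close>,
  differ by an instance of the Jacobi identity.
\<close>

section \<open>The algebra of words\<close>

text \<open>Letters range over all of g, so words are formed without choosing a basis; the price is
  that sending a vector to its one-letter word is not linear, and every letter has to be expanded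
  before sorting makes sense. The obstacle is that an unspecified rule selects the descent, so the
  rewriting equation is available at only one descent of each word. That the sorting map vanishes on
  u (x y - y x - [x,y]) v says exactly that the word u x y v may be rewritten at this descent, and
  at the selected descent it holds by construction. Hence it suffices to show that the relators at
  any two descents of one word have the same value; their difference is, by a polynomial identity in
  noncommuting variables, a combination of relators in smaller words. The degreewise cosets of the
  tensor algebra only have to be matched with words at the end: each family of cosets is the image
  of a single combination of words, and equality in U(g) becomes membership in the span of the
  relators.\<close>

abbreviation mon :: "'g list \<Rightarrow> ('g list \<Rightarrow>\<^sub>0 'k::field)" where
  "mon w \<equiv> Poly_Mapping.single w 1"

interpretation W: vector_space "word_scale :: 'k::field \<Rightarrow> ('g list \<Rightarrow>\<^sub>0 'k) \<Rightarrow> _"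
  by (rule vector_space_word_scale)

interpretation WW: vector_space_pair
  "word_scale :: 'k::field \<Rightarrow> ('g list \<Rightarrow>\<^sub>0 'k) \<Rightarrow> _"
  "word_scale :: 'k::field \<Rightarrow> ('h list \<Rightarrow>\<^sub>0 'k) \<Rightarrow> _"
  by unfold_locales

lemma mon_Nil: "mon [] = 1"
  using single_one[where ?'a = "'a list"] by (simp add: zero_list_def)

lemma mon_append: "mon (u @ v) = mon u * mon v"
  by (simp add: mult_single plus_list_def)

lemma mon_Cons: "mon (x # v) = mon [x] * mon v"
  by (simp flip: mon_append)

lemma mon_append_Cons: "mon (u @ x # v) = mon u * mon [x] * mon v"
  by (simp flip: mon_append)

lemma word_scale_eq_mult: "word_scale c p = Poly_Mapping.single [] c * p"
  unfolding word_scale_def mult_map_scale_conv_mult zero_list_def by simp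

lemma word_scale_mult_left: "word_scale c p * q = word_scale c (p * q)"
  by (simp add: word_scale_eq_mult mult.assoc)

lemma poly_mapping_eq_sum_mon:
  "(p :: 'g list \<Rightarrow>\<^sub>0 'k::field) = (\<Sum>w\<in>Poly_Mapping.keys p. word_scale (Poly_Mapping.lookup p w) (mon w))"
proof (rule poly_mapping_eqI)
  fix v
  have "Poly_Mapping.lookup (\<Sum>w\<in>Poly_Mapping.keys p. word_scale (Poly_Mapping.lookup p w) (mon w)) v
      = (\<Sum>w\<in>Poly_Mapping.keys p. if w = v then Poly_Mapping.lookup p w else 0)"
    by (simp add: lookup_sum lookup_word_scale lookup_single when_def if_distrib[of "(*) _"] cong: if_cong)
  also have "\<dots> = Poly_Mapping.lookup p v"
    by (simp add: in_keys_iff)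
  finally show "Poly_Mapping.lookup p v = Poly_Mapping.lookup (\<Sum>w\<in>Poly_Mapping.keys p. word_scale (Poly_Mapping.lookup p w) (mon w)) v" ..
qed

text \<open>Words need to be treated only if they occur in \<open>p\<close>, so the same induction
  serves elements restricted to a given degree or to canonical words.\<close>

lemma word_induct:
  fixes p :: "'g list \<Rightarrow>\<^sub>0 'k::field"
  assumes "P 0" "\<And>p q. P p \<Longrightarrow> P q \<Longrightarrow> P (p + q)" "\<And>c p. P p \<Longrightarrow> P (word_scale c p)"
    and mon: "\<And>w. w \<in> Poly_Mapping.keys p \<Longrightarrow> P (mon w)"
  shows "P p"
proof -
  have "P (\<Sum>w\<in>A. word_scale (f w) (mon w))" if "A \<subseteq> Poly_Mapping.keys p" for A f
    using finite_subset[OF that finite_keys] that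
    by (induct A rule: finite_induct) (auto intro: assms)
  then show ?thesis
    by (subst poly_mapping_eq_sum_mon) blast
qed

text \<open>Scaling is left multiplication by a multiple of the empty word; its centrality is what
  allows scalars to be pulled out of a right factor.\<close>

lemma single_Nil_commute:
  fixes p :: "'g list \<Rightarrow>\<^sub>0 'k::field"
  shows "Poly_Mapping.single [] c * p = p * Poly_Mapping.single [] c"
proof (induct p rule: word_induct)
  case (3 d p)
  have "Poly_Mapping.single [] c * Poly_Mapping.single [] d
      = Poly_Mapping.single [] d * Poly_Mapping.single ([] :: 'g list) c"
    by (simp add: mult_single mult.commute)
  then have "Poly_Mapping.single [] c * (Poly_Mapping.single [] d * p)
      = Poly_Mapping.single [] d * (Poly_Mapping.single [] c * p)"
    by (simp flip: mult.assoc)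
  then show ?case
    using 3 by (simp add: word_scale_eq_mult mult.assoc)
qed (auto simp: algebra_simps mult_single plus_list_def)

lemma word_scale_mult_right: "p * word_scale c q = word_scale c (p * q)"
  unfolding word_scale_eq_mult single_Nil_commute[of c] by (simp add: mult.assoc)

lemmas word_scale_mult = word_scale_mult_left word_scale_mult_right

abbreviation word_linear :: "(('g list \<Rightarrow>\<^sub>0 'k::field) \<Rightarrow> ('h list \<Rightarrow>\<^sub>0 'k)) \<Rightarrow> bool" where
  "word_linear \<equiv> Vector_Spaces.linear word_scale word_scale"

lemma word_linearI:
  assumes "\<And>p q. f (p + q) = f p + f q" "\<And>c p. f (word_scale c p) = word_scale c (f p)"
  shows "word_linear f"
  by (simp add: Vector_Spaces.linear_iff assms vector_space_pair_def vector_space_word_scale)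

lemma word_linear_eqI:
  assumes "word_linear f" "word_linear g" "\<And>w. w \<in> Poly_Mapping.keys p \<Longrightarrow> f (mon w) = g (mon w)"
  shows "f p = g p"
  by (induct p rule: word_induct)
    (simp_all add: assms WW.linear_0 WW.linear_add WW.linear_scale)

definition lin_ext :: "('g list \<Rightarrow> ('h list \<Rightarrow>\<^sub>0 'k::field)) \<Rightarrow> ('g list \<Rightarrow>\<^sub>0 'k) \<Rightarrow> ('h list \<Rightarrow>\<^sub>0 'k)" where
  "lin_ext f p = (\<Sum>w\<in>Poly_Mapping.keys p. word_scale (Poly_Mapping.lookup p w) (f w))"

lemma lin_ext_superset:
  assumes "finite A" "Poly_Mapping.keys p \<subseteq> A"
  shows "lin_ext f p = (\<Sum>w\<in>A. word_scale (Poly_Mapping.lookup p w) (f w))"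
  unfolding lin_ext_def using assms
  by (intro sum.mono_neutral_left) (auto simp: in_keys_iff)

lemma word_linear_lin_ext:
  fixes f :: "'g list \<Rightarrow> ('h list \<Rightarrow>\<^sub>0 'k::field)"
  shows "word_linear (lin_ext f)"
proof (rule word_linearI)
  fix p q :: "'g list \<Rightarrow>\<^sub>0 'k"
  let ?A = "Poly_Mapping.keys p \<union> Poly_Mapping.keys q"
  have "Poly_Mapping.keys (p + q) \<subseteq> ?A"
    by (rule keys_add)
  then have "lin_ext f (p + q) = (\<Sum>w\<in>?A. word_scale (Poly_Mapping.lookup (p + q) w) (f w))"
    by (intro lin_ext_superset) auto
  also have "\<dots> = lin_ext f p + lin_ext f q"
    by (simp add: lookup_add W.scale_left_distrib sum.distrib lin_ext_superset[of ?A])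
  finally show "lin_ext f (p + q) = lin_ext f p + lin_ext f q" .
next
  fix c and p :: "'g list \<Rightarrow>\<^sub>0 'k"
  have "Poly_Mapping.keys (word_scale c p) \<subseteq> Poly_Mapping.keys p"
    by (auto simp: in_keys_iff lookup_word_scale)
  then show "lin_ext f (word_scale c p) = word_scale c (lin_ext f p)"
    by (simp add: lin_ext_superset[of "Poly_Mapping.keys p"] lookup_word_scale W.scale_sum_right)
qed

lemma lin_ext_mon [simp]: "lin_ext f (mon w) = f w"
  by (simp add: lin_ext_def)

lemmas lin_ext_add = WW.linear_add[OF word_linear_lin_ext]
  and lin_ext_diff = WW.linear_diff[OF word_linear_lin_ext]
  and lin_ext_0 = WW.linear_0[OF word_linear_lin_ext]
  and lin_ext_sum = WW.linear_sum[OF word_linear_lin_ext]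
  and lin_ext_scale = WW.linear_scale[OF word_linear_lin_ext]

section \<open>Normal forms by sorting words\<close>

text \<open>Substitute \<open>x' * y' = y' * x' + i' + c'\<close> in the first product and
  \<open>x * y = y * x + i + c\<close> in the second; the two copies of
  \<open>u * c * m * c' * v\<close> cancel.\<close>

lemma disjoint_descents_identity:
  fixes u :: "'a::ring"
  assumes "c = x * y - y * x - i" "c' = x' * y' - y' * x' - i'"
  shows "u * c * (m * x' * y' * v) - u * x * y * m * c' * v
    = u * c * (m * y' * x' * v) + u * c * m * i' * v - u * y * x * m * c' * v - u * i * m * (c' * v)"
  unfolding assms by (simp add: algebra_simps)

text \<open>Here \<open>xy\<close>, \<open>yz\<close>, \<open>xz\<close> stand for the brackets of
  two letters, and \<open>x_yz\<close>, \<open>y_xz\<close> for [x,[y,z]] and [y,[x,z]]. The six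
  orderings of the letters form a hexagon whose edges are adjacent swaps: the left side has the two
  edges at x y z, the first four terms on the right are the other four edges, and the last three
  move a bracket past the third letter. The Jacobi identity is built in by writing
  \<open>x_yz - y_xz\<close> for [[x,y],z], which makes the double brackets cancel.\<close>

lemma overlapping_descents_identity:
  fixes u :: "'a::ring"
  shows "u * (x * y - y * x - xy) * (z * v) - u * x * (y * z - z * y - yz) * v
    = - (u * y * (x * z - z * x - xz) * v) - u * (y * z - z * y - yz) * (x * v)
      + u * (x * z - z * x - xz) * (y * v) + u * z * (x * y - y * x - xy) * v
      - u * (xy * z - z * xy - (x_yz - y_xz)) * v + u * (x * yz - yz * x - x_yz) * v
      - u * (y * xz - xz * y - y_xz) * v"
  by (simp add: algebra_simps)

locale pbw = lie_algebra scale bracket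
  for scale :: "'k::field \<Rightarrow> 'g::ab_group_add \<Rightarrow> 'g" and bracket :: "'g \<Rightarrow> 'g \<Rightarrow> 'g" +
  fixes B :: "'g set" and r :: "'g rel"
  assumes independent: "\<not> dependent B"
    and spanning: "span B = UNIV"
    and order: "linear_order_on B r"
begin

section \<open>The bracket and coordinates with respect to the basis\<close>

lemma bracket_add: "bracket x (y + z) = bracket x y + bracket x z"
    "bracket (x + y) z = bracket x z + bracket y z"
  using linear_right linear_left by (auto simp: Vector_Spaces.linear_iff)

lemma bracket_scale: "bracket x (scale c y) = scale c (bracket x y)"
    "bracket (scale c x) y = scale c (bracket x y)"
  using linear_right linear_left by (auto simp: Vector_Spaces.linear_iff)

lemma bracket_0: "bracket x 0 = 0" "bracket 0 y = 0"
  using bracket_add(1)[of x 0 0] bracket_add(2)[of 0 0 y] by auto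

lemma bracket_anticommute: "bracket y x = - bracket x y"
proof -
  have "0 = bracket (x + y) (x + y)"
    by (simp only: alternating)
  also have "\<dots> = bracket x y + bracket y x"
    by (simp only: bracket_add) (simp add: alternating)
  finally have "bracket x y + bracket y x = 0"
    by (rule sym)
  then show ?thesis
    by (simp add: add_eq_0_iff)
qed

lemma bracket_minus: "bracket x (- y) = - bracket x y"
  using bracket_scale(1)[of x "-1" y] by simp

lemma basis_induct:
  assumes "P 0" "\<And>a b. P a \<Longrightarrow> P b \<Longrightarrow> P (a + b)" "\<And>c a. P a \<Longrightarrow> P (scale c a)"
    and "\<And>b. b \<in> B \<Longrightarrow> P b"
  shows "P a"
  by (rule span_induct_alt[of a B]) (auto simp: spanning intro: assms)

abbreviation coord :: "'g \<Rightarrow> 'g \<Rightarrow> 'k" where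
  "coord \<equiv> representation B"

text \<open>A linear substitute for \<open>mon [a]\<close>, with which it agrees on basis elements
  and, modulo the linearity relators, everywhere.\<close>

definition iota :: "'g \<Rightarrow> ('g list \<Rightarrow>\<^sub>0 'k)" where
  "iota a = (\<Sum>b | coord a b \<noteq> 0. word_scale (coord a b) (mon [b]))"

lemma iota_superset:
  assumes "finite A" "{b. coord a b \<noteq> 0} \<subseteq> A"
  shows "iota a = (\<Sum>b\<in>A. word_scale (coord a b) (mon [b]))"
  unfolding iota_def using assms by (intro sum.mono_neutral_left) auto

lemma iota_add: "iota (a + b) = iota a + iota b"
proof -
  let ?A = "{z. coord a z \<noteq> 0} \<union> {z. coord b z \<noteq> 0}"
  have "finite ?A"
    by (simp add: finite_representation)
  moreover have "coord (a + b) = (\<lambda>z. coord a z + coord b z)"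
    using representation_add[OF independent] by (simp add: spanning)
  ultimately show ?thesis
    by (subst (1 2 3) iota_superset[of ?A]) (auto simp: W.scale_left_distrib sum.distrib)
qed

lemma iota_scale: "iota (scale c a) = word_scale c (iota a)"
proof -
  have "coord (scale c a) = (\<lambda>z. c * coord a z)"
    using representation_scale[OF independent] by (simp add: spanning)
  moreover have "finite {z. coord a z \<noteq> 0}"
    by (simp add: finite_representation)
  ultimately show ?thesis
    by (subst (1 2) iota_superset[of "{z. coord a z \<noteq> 0}"])
      (auto simp: W.scale_sum_right)
qed

lemma iota_0: "iota 0 = 0"
  using iota_scale[of 0 0] by simp

lemma iota_minus: "iota (- a) = - iota a"
  using iota_scale[of "-1" a] by simp

lemma iota_basis: "b \<in> B \<Longrightarrow> iota b = mon [b]"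
  by (simp add: iota_def representation_basis[OF independent])

section \<open>Descents and the rewriting of words\<close>

definition gt :: "'g \<Rightarrow> 'g \<Rightarrow> bool" where
  "gt x y \<longleftrightarrow> x \<noteq> y \<and> (y, x) \<in> r"

lemma gt_basis: "gt x y \<Longrightarrow> x \<in> B" "gt x y \<Longrightarrow> y \<in> B"
  using order by (auto simp: gt_def linear_order_on_def partial_order_on_def preorder_on_def)

lemma gt_trans: "gt x y \<Longrightarrow> gt y z \<Longrightarrow> gt x z"
  using order unfolding gt_def linear_order_on_def partial_order_on_def preorder_on_def
  by (metis antisymD transD)

lemma gt_asym: "gt x y \<Longrightarrow> \<not> gt y x"
  using order unfolding gt_def linear_order_on_def partial_order_on_def
  by (metis antisymD)

lemma gt_total: "x \<in> B \<Longrightarrow> y \<in> B \<Longrightarrow> x = y \<or> gt x y \<or> gt y x"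
  using order unfolding gt_def linear_order_on_def total_on_def by metis

lemma rel_iff_not_gt: "x \<in> B \<Longrightarrow> y \<in> B \<Longrightarrow> (x, y) \<in> r \<longleftrightarrow> \<not> gt x y"
  using order gt_total[of x y] unfolding gt_def
    linear_order_on_def partial_order_on_def preorder_on_def refl_on_def
  by (metis antisymD)

primrec inversions :: "'g list \<Rightarrow> nat" where
  "inversions [] = 0"
| "inversions (x # w) = length (filter (gt x) w) + inversions w"

lemma inversions_swap: "gt x y \<Longrightarrow> inversions (u @ y # x # v) < inversions (u @ x # y # v)"
  by (induct u) (auto simp: gt_asym)

definition descent_at :: "'g list \<Rightarrow> 'g list \<times> 'g \<times> 'g \<times> 'g list \<Rightarrow> bool" where
  "descent_at w = (\<lambda>(u, x, y, v). w = u @ x # y # v \<and> gt x y)"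

lemma descent_at_iff: "descent_at w (u, x, y, v) \<longleftrightarrow> w = u @ x # y # v \<and> gt x y"
  by (simp add: descent_at_def)

lemma descent_at_SOME:
  assumes "descent_at w d" "(SOME d. descent_at w d) = (u, x, y, v)"
  shows "w = u @ x # y # v" "gt x y"
  using someI[of "descent_at w", OF assms(1)] by (simp_all add: assms(2) descent_at_iff)

text \<open>The bracket is written out in coordinates so that the recursive calls are on words;
  \<open>S_iota\<close> later folds the sum into the linear extension \<open>S\<close>, which exists
  only once \<open>sigma\<close> is defined.\<close>

function sigma :: "'g list \<Rightarrow> ('g list \<Rightarrow>\<^sub>0 'k)" where
  "sigma w = (if \<exists>d. descent_at w d
     then (case SOME d. descent_at w d of (u, x, y, v) \<Rightarrow> sigma (u @ y # x # v) +
       (\<Sum>z | coord (bracket x y) z \<noteq> 0. word_scale (coord (bracket x y) z) (sigma (u @ z # v))))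
     else mon w)"
  by auto

termination
\<comment> \<open>Length has to come first: the letters of the expanded bracket may create new
  inversions, but each such word is one letter shorter.\<close>
proof (relation "measures [length, inversions]", goal_cases)
  case 1
  show ?case by simp
next
  case (2 w u q x q' y v)
  then have "w = u @ x # y # v" "gt x y"
    using descent_at_SOME[of w _ u x y v] by auto
  then show ?case
    by (simp add: inversions_swap)
next
  case (3 w u q x q' y v z)
  then have "w = u @ x # y # v"
    using descent_at_SOME(1)[of w _ u x y v] by auto
  then show ?case
    by simp
qed

declare sigma.simps [simp del]

abbreviation S :: "('g list \<Rightarrow>\<^sub>0 'k) \<Rightarrow> ('g list \<Rightarrow>\<^sub>0 'k)" where
  "S \<equiv> lin_ext sigma"

text \<open>Formed with \<open>iota\<close> rather than with one-letter words, which makes it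
  bilinear in \<open>a\<close> and \<open>b\<close>.\<close>

definition comm_relator :: "'g \<Rightarrow> 'g \<Rightarrow> ('g list \<Rightarrow>\<^sub>0 'k)" where
  "comm_relator a b = iota a * iota b - iota b * iota a - iota (bracket a b)"

lemma S_iota:
  "S (mon u * iota a * mon v) = (\<Sum>z | coord a z \<noteq> 0. word_scale (coord a z) (sigma (u @ z # v)))"
  unfolding iota_def
  by (simp add: sum_distrib_left sum_distrib_right lin_ext_sum lin_ext_scale word_scale_mult
      flip: mon_append)

lemma sigma_no_descent:
  assumes "\<And>u x y v. w = u @ x # y # v \<Longrightarrow> \<not> gt x y"
  shows "sigma w = mon w"
  using assms by (subst sigma.simps) (auto simp: descent_at_iff)

text \<open>The descent obtained is the one selected by \<open>SOME\<close>, in general not the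
  given one, which only witnesses that a descent exists.\<close>

lemma sigma_descent:
  assumes "w = u @ x # y # v" "gt x y"
  obtains u x y v where "w = u @ x # y # v" "gt x y"
    "sigma w = sigma (u @ y # x # v) + S (mon u * iota (bracket x y) * mon v)"
proof -
  obtain u' x' y' v' where d: "(SOME d. descent_at w d) = (u', x', y', v')"
    by (metis prod_cases4)
  have ex: "\<exists>d. descent_at w d"
    using assms by (auto simp: descent_at_iff)
  then have "descent_at w (u', x', y', v')"
    unfolding d[symmetric] by (rule someI_ex)
  moreover have "sigma w = sigma (u' @ y' # x' # v') + S (mon u' * iota (bracket x' y') * mon v')"
    unfolding S_iota using ex by (subst sigma.simps) (simp add: d)
  ultimately show thesis
    using that by (auto simp: descent_at_iff)
qed

text \<open>The right side is the error made when \<open>sigma\<close> is computed by rewriting at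
  this descent, so its vanishing means that this choice is admissible.\<close>

lemma S_comm_relator:
  assumes "gt x y"
  shows "S (mon u * comm_relator x y * mon v)
    = sigma (u @ x # y # v) - sigma (u @ y # x # v) - S (mon u * iota (bracket x y) * mon v)"
proof -
  have "mon u * comm_relator x y * mon v
      = mon (u @ [x] @ [y] @ v) - mon (u @ [y] @ [x] @ v) - mon u * iota (bracket x y) * mon v"
    unfolding mon_append comm_relator_def
    by (simp add: algebra_simps iota_basis[OF gt_basis(1)[OF assms]] iota_basis[OF gt_basis(2)[OF assms]])
  then show ?thesis
    by (simp add: lin_ext_diff)
qed

text \<open>The relator is antisymmetric and zero on the diagonal, so by totality of the order the
  descents account for all pairs of basis elements; bilinearity does the rest.\<close>

lemma S_comm_relator_bilinear:
  assumes "\<And>x y. gt x y \<Longrightarrow> S (mon u * comm_relator x y * mon v) = 0"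
  shows "S (mon u * comm_relator a b * mon v) = 0"
proof -
  have basis: "S (mon u * comm_relator x y * mon v) = 0" if xy: "x \<in> B" "y \<in> B" for x y
  proof -
    have anti: "comm_relator y x = - comm_relator x y"
      by (simp add: comm_relator_def bracket_anticommute[of x y] iota_minus)
    have "comm_relator x x = 0"
      by (simp add: comm_relator_def alternating iota_0)
    then show ?thesis
      using gt_total[OF xy] assms[of x y] assms[of y x]
      by (auto simp: lin_ext_0 anti WW.linear_neg[OF word_linear_lin_ext])
  qed
  have add: "comm_relator (a + b) c = comm_relator a c + comm_relator b c"
    "comm_relator c (a + b) = comm_relator c a + comm_relator c b" for a b c
    by (simp_all add: comm_relator_def iota_add bracket_add algebra_simps)
  have scl: "comm_relator (scale t a) c = word_scale t (comm_relator a c)"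
    "comm_relator c (scale t a) = word_scale t (comm_relator c a)" for t a c
    by (simp_all add: comm_relator_def iota_scale bracket_scale word_scale_mult W.scale_right_diff_distrib)
  have zero: "comm_relator 0 c = 0" "comm_relator c 0 = 0" for c
    by (simp_all add: comm_relator_def iota_0 bracket_0)
  have "S (mon u * comm_relator a y * mon v) = 0" if "y \<in> B" for y
    by (induct a rule: basis_induct)
      (simp_all add: zero add scl basis that lin_ext_0 lin_ext_add lin_ext_scale word_scale_mult
        distrib_left distrib_right)
  then show ?thesis
    by (induct b rule: basis_induct)
      (simp_all add: zero add scl lin_ext_0 lin_ext_add lin_ext_scale word_scale_mult
        distrib_left distrib_right)
qed

section \<open>Independence of the selected descent\<close>

lemma S_iota_left:
  assumes "\<And>z. S (mon (u @ z # m) * p) = 0"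
  shows "S (mon u * iota g * mon m * p) = 0"
proof (induct g rule: basis_induct)
  case (4 b)
  have "mon u * iota b * mon m = mon (u @ b # m)"
    by (simp add: iota_basis[OF 4] mon_append_Cons)
  then show ?case
    using assms by simp
qed (simp_all add: iota_0 iota_add iota_scale lin_ext_0 lin_ext_add lin_ext_scale word_scale_mult
        distrib_left distrib_right)

lemma S_iota_right:
  assumes "\<And>z. S (p * mon (m @ z # v)) = 0"
  shows "S (p * mon m * iota g * mon v) = 0"
proof (induct g rule: basis_induct)
  case (4 b)
  have "mon m * iota b * mon v = mon (m @ b # v)"
    by (simp add: iota_basis[OF 4] mon_append_Cons)
  then show ?case
    using assms by (simp add: mult.assoc)
qed (simp_all add: iota_0 iota_add iota_scale lin_ext_0 lin_ext_add lin_ext_scale word_scale_mult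
        distrib_left distrib_right)

text \<open>By \<open>S_comm_relator\<close>, this says that every descent of \<open>w\<close> may
  serve as the first rewriting step.\<close>

definition compatible :: "'g list \<Rightarrow> bool" where
  "compatible w \<longleftrightarrow> (\<forall>u x y v. w = u @ x # y # v \<longrightarrow> gt x y \<longrightarrow> S (mon u * comm_relator x y * mon v) = 0)"

text \<open>In each of the four terms left by \<open>disjoint_descents_identity\<close>, the descent
  away from the relator is either already swapped, which lowers the inversions, or replaced by its
  bracket, which lowers the length.\<close>

lemma S_comm_relator_disjoint:
  assumes w: "w = u @ x # y # m @ x' # y' # v" and gt: "gt x y" "gt x' y'"
    and shorter: "\<And>u v a b. length u + length v + 2 < length w \<Longrightarrow> S (mon u * comm_relator a b * mon v) = 0"
    and fewer: "\<And>w'. length w' = length w \<Longrightarrow> inversions w' < inversions w \<Longrightarrow> compatible w'"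
  shows "S (mon u * comm_relator x y * mon (m @ x' # y' # v))
    = S (mon (u @ x # y # m) * comm_relator x' y' * mon v)"
proof -
  note B = gt_basis[OF gt(1)] gt_basis[OF gt(2)]
  note iota = iota_basis[OF B(1)] iota_basis[OF B(2)] iota_basis[OF B(3)] iota_basis[OF B(4)]
  have a1: "S (mon u * comm_relator x y * mon (m @ y' # x' # v)) = 0"
    using fewer[of "u @ x # y # m @ y' # x' # v"] inversions_swap[OF gt(2), of "u @ x # y # m" v] gt
    unfolding compatible_def by (simp add: w)
  have a2: "S (mon u * comm_relator x y * mon m * iota (bracket x' y') * mon v) = 0"
    by (rule S_iota_right, rule shorter) (simp add: w)
  have a3: "S (mon (u @ y # x # m) * comm_relator x' y' * mon v) = 0"
    using fewer[of "u @ y # x # m @ x' # y' # v"] inversions_swap[OF gt(1), of u "m @ x' # y' # v"] gt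
    unfolding compatible_def by (auto simp: w dest!: spec[of _ "u @ y # x # m"])
  have a4: "S (mon u * iota (bracket x y) * mon m * (comm_relator x' y' * mon v)) = 0"
    by (rule S_iota_left, subst mult.assoc[symmetric], rule shorter) (simp add: w)
  have m: "mon (m @ y' # x' # v) = mon m * iota y' * iota x' * mon v"
    "mon (m @ x' # y' # v) = mon m * iota x' * iota y' * mon v"
    "mon (u @ y # x # m) = mon u * iota y * iota x * mon m"
    "mon (u @ x # y # m) = mon u * iota x * iota y * mon m"
    by (simp_all only: mon_append_Cons mon_Cons[of _ v] mon_Cons[of _ m] iota mult.assoc)
  have "mon u * comm_relator x y * mon (m @ x' # y' # v) - mon (u @ x # y # m) * comm_relator x' y' * mon v
    = mon u * comm_relator x y * mon (m @ y' # x' # v)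
      + mon u * comm_relator x y * mon m * iota (bracket x' y') * mon v
      - mon (u @ y # x # m) * comm_relator x' y' * mon v
      - mon u * iota (bracket x y) * mon m * (comm_relator x' y' * mon v)"
    unfolding m by (intro disjoint_descents_identity comm_relator_def)
  from arg_cong[OF this, of S] show ?thesis
    by (simp add: lin_ext_add lin_ext_diff a1 a2 a3 a4)
qed

text \<open>For overlapping descents the difference of the two relators is, up to relators already
  known to vanish, the Jacobi identity.\<close>

lemma S_comm_relator_overlap:
  assumes w: "w = u @ x # y # z # v" and gt: "gt x y" "gt y z"
    and shorter: "\<And>u v a b. length u + length v + 2 < length w \<Longrightarrow> S (mon u * comm_relator a b * mon v) = 0"
    and fewer: "\<And>w'. length w' = length w \<Longrightarrow> inversions w' < inversions w \<Longrightarrow> compatible w'"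
  shows "S (mon u * comm_relator x y * mon (z # v)) = S (mon (u @ [x]) * comm_relator y z * mon v)"
proof -
  note gt3 = gt_trans[OF gt]
  note B = gt_basis[OF gt(1)] gt_basis[OF gt(2)]
  note iota = iota_basis[OF B(1)] iota_basis[OF B(2)] iota_basis[OF B(4)]
  \<comment> \<open>The four orderings other than \<open>x\<close>, \<open>y\<close>,
    \<open>z\<close> and the sorted \<open>z\<close>, \<open>y\<close>, \<open>x\<close>. Each
    contains one of the four remaining edge relators of the hexagon, and each has fewer inversions
    than \<open>w\<close>.\<close>
  have 1: "inversions (u @ y # x # z # v) < inversions w"
    using inversions_swap[OF gt(1), of u "z # v"] by (simp add: w)
  have 2: "inversions (u @ y # z # x # v) < inversions w"
    using 1 inversions_swap[OF gt3, of "u @ [y]" v] by simp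
  have 3: "inversions (u @ x # z # y # v) < inversions w"
    using inversions_swap[OF gt(2), of "u @ [x]" v] by (simp add: w)
  have 4: "inversions (u @ z # x # y # v) < inversions w"
    using 3 inversions_swap[OF gt3, of u "y # v"] by simp
  have a1: "S (mon (u @ [y]) * comm_relator x z * mon v) = 0"
    using fewer[OF _ 1] gt3 unfolding compatible_def by (auto simp: w dest!: spec[of _ "u @ [y]"])
  have a2: "S (mon u * comm_relator y z * mon (x # v)) = 0"
    using fewer[OF _ 2] gt unfolding compatible_def by (simp add: w)
  have a3: "S (mon u * comm_relator x z * mon (y # v)) = 0"
    using fewer[OF _ 3] gt3 unfolding compatible_def by (simp add: w)
  have a4: "S (mon (u @ [z]) * comm_relator x y * mon v) = 0"
    using fewer[OF _ 4] gt unfolding compatible_def by (auto simp: w dest!: spec[of _ "u @ [z]"])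
  have a5: "S (mon u * comm_relator a b * mon v) = 0" for a b
    by (rule shorter) (simp add: w)
  have m: "mon (u @ [x]) = mon u * iota x" "mon (u @ [y]) = mon u * iota y" "mon (u @ [z]) = mon u * iota z"
    "mon (x # v) = iota x * mon v" "mon (y # v) = iota y * mon v" "mon (z # v) = iota z * mon v"
    by (simp_all only: mon_append iota) (simp_all only: mon_Cons[of _ v])
  \<comment> \<open>The Jacobi identity in Leibniz form, the shape that
    \<open>overlapping_descents_identity\<close> expects.\<close>
  have "bracket (bracket x y) z = bracket x (bracket y z) - bracket y (bracket x z)"
    using jacobi[of x y z]
      minus_unique[of "bracket z (bracket x y)" "bracket x (bracket y z) + bracket y (bracket z x)"]
    by (simp add: bracket_anticommute[of "bracket x y" z] bracket_anticommute[of x z] bracket_minus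
        ac_simps)
  then have J: "iota (bracket (bracket x y) z)
      = iota (bracket x (bracket y z)) - iota (bracket y (bracket x z))"
    using iota_add[of _ "- bracket y (bracket x z)"] by (simp add: iota_minus)
  have "mon u * comm_relator x y * mon (z # v) - mon (u @ [x]) * comm_relator y z * mon v
    = - (mon (u @ [y]) * comm_relator x z * mon v) - mon u * comm_relator y z * mon (x # v)
      + mon u * comm_relator x z * mon (y # v) + mon (u @ [z]) * comm_relator x y * mon v
      - mon u * comm_relator (bracket x y) z * mon v + mon u * comm_relator x (bracket y z) * mon v
      - mon u * comm_relator y (bracket x z) * mon v"
    unfolding m comm_relator_def J by (rule overlapping_descents_identity)
  from arg_cong[OF this, of S] show ?thesis
    by (simp add: lin_ext_add lin_ext_diff WW.linear_neg[OF word_linear_lin_ext] a1 a2 a3 a4 a5)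
qed

text \<open>The relator at the selected descent is killed because \<open>sigma\<close> is computed
  there, so all that is left is to compare two arbitrary descents of the same word.\<close>

lemma compatible_all: "compatible w"
proof (induct w rule: wf_induct_rule[OF wf_measures[of "[length, inversions]"]])
  case (1 w)
  have fewer: "compatible w'" if "length w' = length w" "inversions w' < inversions w" for w'
    using 1[of w'] that by simp
  have shorter: "S (mon u * comm_relator a b * mon v) = 0" if "length u + length v + 2 < length w" for u v a b
  proof (rule S_comm_relator_bilinear)
    fix x y assume "gt x y"
    moreover have "compatible (u @ x # y # v)"
      using that by (intro 1) simp
    ultimately show "S (mon u * comm_relator x y * mon v) = 0"
      by (simp add: compatible_def)
  qed
  have eq: "S (mon u * comm_relator x y * mon v) = S (mon u' * comm_relator x' y' * mon v')"
    if w: "w = u @ x # y # v" "w = u' @ x' # y' # v'" and gt: "gt x y" "gt x' y'"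
      and le: "length u \<le> length u'" for u x y v u' x' y' v'
  proof -
    obtain s where s: "u' = u @ s" "x # y # v = s @ x' # y' # v'"
      using w le append_eq_append_conv2[of u "x # y # v" u' "x' # y' # v'"] by auto
    \<comment> \<open>The offset between the two descents: the same place, one letter (they share a
      letter), or at least two letters (disjoint).\<close>
    consider "s = []" | "s = [x]" | m where "s = x # y # m"
      using s(2) by (cases s; cases "tl s") auto
    then show ?thesis
    proof cases
      case 1
      with s show ?thesis by simp
    next
      case 2
      with s gt w S_comm_relator_overlap[of w u x y y' v'] shorter fewer show ?thesis
        by simp
    next
      case 3
      with s gt w S_comm_relator_disjoint[of w u x y m x' y' v'] shorter fewer show ?thesis
        by simp
    qed
  qed
  show ?case
    unfolding compatible_def
  proof (intro allI impI)
    fix u x y v assume w: "w = u @ x # y # v" "gt x y"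
    \<comment> \<open>This is the selected descent. Since \<open>eq\<close> requires the left
      descent first, it is used in both directions to carry the vanishing over to the given
      one.\<close>
    from sigma_descent[OF w] obtain u' x' y' v' where
      w': "w = u' @ x' # y' # v'" "gt x' y'"
      and "sigma w = sigma (u' @ y' # x' # v') + S (mon u' * iota (bracket x' y') * mon v')" .
    then have 0: "S (mon u' * comm_relator x' y' * mon v') = 0"
      by (simp add: S_comm_relator)
    then show "S (mon u * comm_relator x y * mon v) = 0"
      using eq[OF w(1) w'(1)] eq[OF w'(1) w(1)] w(2) w'(2) by (metis nle_le)
  qed
qed

lemma S_comm_relator_eq_0: "S (p * comm_relator a b * q) = 0"
proof (induct p rule: word_induct)
  case (4 u)
  show ?case
  proof (induct q rule: word_induct)
    case (4 v)
    show ?case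
      by (rule S_comm_relator_bilinear) (use compatible_all in \<open>simp add: compatible_def\<close>)
  qed (simp_all add: lin_ext_0 lin_ext_add lin_ext_scale word_scale_mult distrib_left)
qed (simp_all add: lin_ext_0 lin_ext_add lin_ext_scale word_scale_mult distrib_right)

section \<open>Normal forms and the subspace of relations\<close>

definition letters_product :: "'g list \<Rightarrow> ('g list \<Rightarrow>\<^sub>0 'k)" where
  "letters_product w = prod_list (map iota w)"

lemma letters_product_append: "letters_product (u @ v) = letters_product u * letters_product v"
  by (simp add: letters_product_def)

lemma letters_product_Cons: "letters_product (x # v) = iota x * letters_product v"
  by (simp add: letters_product_def)

lemma letters_product_Nil: "letters_product [] = 1"
  by (simp add: letters_product_def)

abbreviation expand :: "('g list \<Rightarrow>\<^sub>0 'k) \<Rightarrow> ('g list \<Rightarrow>\<^sub>0 'k)" where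
  "expand \<equiv> lin_ext letters_product"

definition normal_form :: "('g list \<Rightarrow>\<^sub>0 'k) \<Rightarrow> ('g list \<Rightarrow>\<^sub>0 'k)" where
  "normal_form p = S (expand p)"

lemma word_linear_normal_form: "word_linear normal_form"
  by (rule word_linearI) (simp_all add: normal_form_def lin_ext_add lin_ext_scale)

text \<open>The contexts \<open>u\<close> and \<open>v\<close> absorb further letters on both sides,
  so the linear span is already a two-sided ideal.\<close>

definition relators :: "('g list \<Rightarrow>\<^sub>0 'k) set" where
  "relators = {mon (u @ [a + b] @ v) - mon (u @ [a] @ v) - mon (u @ [b] @ v) | u v a b. True}
    \<union> {mon (u @ [scale c a] @ v) - word_scale c (mon (u @ [a] @ v)) | u v c a. True}
    \<union> {mon (u @ [a, b] @ v) - mon (u @ [b, a] @ v) - mon (u @ [bracket a b] @ v) | u v a b. True}"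

definition relations :: "('g list \<Rightarrow>\<^sub>0 'k) set" where
  "relations = W.span relators"

lemma relators_cases [consumes 1, case_names add scale bracket]:
  assumes "p \<in> relators"
  obtains u v a b where "p = mon (u @ [a + b] @ v) - mon (u @ [a] @ v) - mon (u @ [b] @ v)"
  | u v c a where "p = mon (u @ [scale c a] @ v) - word_scale c (mon (u @ [a] @ v))"
  | u v a b where "p = mon (u @ [a, b] @ v) - mon (u @ [b, a] @ v) - mon (u @ [bracket a b] @ v)"
  using assms unfolding relators_def by blast

text \<open>The expansion is multilinear in the letters and so kills both kinds of linearity
  relators before any sorting; a bracket relator becomes a multiple of
  \<open>comm_relator a b\<close>, which \<open>S\<close> kills.\<close>

lemma normal_form_relator:
  assumes "p \<in> relators"
  shows "normal_form p = 0"
  using assms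
proof (cases p rule: relators_cases)
  case (add u v a b)
  then show ?thesis
    by (simp add: normal_form_def lin_ext_diff letters_product_append letters_product_Cons iota_add
        distrib_left distrib_right lin_ext_0)
next
  case (scale u v c a)
  then show ?thesis
    by (simp add: normal_form_def lin_ext_diff lin_ext_scale letters_product_append
        letters_product_Cons iota_scale word_scale_mult lin_ext_0)
next
  case (bracket u v a b)
  have "expand p = letters_product u * comm_relator a b * letters_product v"
    by (simp add: bracket lin_ext_diff letters_product_append
        letters_product_Cons comm_relator_def left_diff_distrib right_diff_distrib mult.assoc)
  then show ?thesis
    by (simp add: normal_form_def S_comm_relator_eq_0)
qed

lemma relator_relations: "p \<in> relators \<Longrightarrow> p \<in> relations"
  unfolding relations_def by (rule W.span_base)

lemma relations_0: "0 \<in> relations"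
  and relations_add: "p \<in> relations \<Longrightarrow> q \<in> relations \<Longrightarrow> p + q \<in> relations"
  and relations_diff: "p \<in> relations \<Longrightarrow> q \<in> relations \<Longrightarrow> p - q \<in> relations"
  and relations_minus: "p \<in> relations \<Longrightarrow> - p \<in> relations"
  and relations_scale: "p \<in> relations \<Longrightarrow> word_scale c p \<in> relations"
  and relations_sum: "(\<And>i. i \<in> A \<Longrightarrow> f i \<in> relations) \<Longrightarrow> sum f A \<in> relations"
  unfolding relations_def
  by (simp_all add: W.span_zero W.span_add W.span_diff W.span_neg W.span_scale W.span_sum)

lemma relations_induct [consumes 1, case_names 0 add scale relator]:
  assumes "p \<in> relations" "P 0" "\<And>p q. P p \<Longrightarrow> P q \<Longrightarrow> P (p + q)" "\<And>c p. P p \<Longrightarrow> P (word_scale c p)"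
    "\<And>p. p \<in> relators \<Longrightarrow> P p"
  shows "P p"
  by (rule W.span_induct_alt[OF assms(1)[unfolded relations_def]]) (auto intro: assms)

lemma normal_form_relations: "p \<in> relations \<Longrightarrow> normal_form p = 0"
  by (induct p rule: relations_induct)
    (simp_all add: normal_form_relator WW.linear_0[OF word_linear_normal_form]
      WW.linear_add[OF word_linear_normal_form] WW.linear_scale[OF word_linear_normal_form])

lemma relations_mult_mon:
  assumes "p \<in> relations"
  shows "mon l * p * mon q \<in> relations"
  using assms
proof (induct p rule: relations_induct)
  case (relator p)
  have "mon l * p * mon q \<in> relators"
    using relator
  proof (cases p rule: relators_cases)
    case (add u v a b)
    have "mon l * p * mon q = mon ((l @ u) @ [a + b] @ v @ q) - mon ((l @ u) @ [a] @ v @ q)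
        - mon ((l @ u) @ [b] @ v @ q)"
      by (simp add: add algebra_simps flip: mon_append)
    then show ?thesis
      unfolding relators_def by blast
  next
    case (scale u v c a)
    have "mon l * p * mon q = mon ((l @ u) @ [scale c a] @ v @ q)
        - word_scale c (mon ((l @ u) @ [a] @ v @ q))"
      by (simp add: scale algebra_simps word_scale_mult flip: mon_append)
    then show ?thesis
      unfolding relators_def by blast
  next
    case (bracket u v a b)
    have "mon l * p * mon q = mon ((l @ u) @ [a, b] @ v @ q) - mon ((l @ u) @ [b, a] @ v @ q)
        - mon ((l @ u) @ [bracket a b] @ v @ q)"
      by (simp add: bracket algebra_simps flip: mon_append)
    then show ?thesis
      unfolding relators_def by blast
  qed
  then show ?case
    by (rule relator_relations)
qed (simp_all add: relations_0 relations_add relations_scale word_scale_mult algebra_simps)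

lemma relations_mult:
  assumes "p \<in> relations"
  shows "l * p * q \<in> relations"
proof (induct l rule: word_induct)
  case (4 u)
  show ?case
    by (induct q rule: word_induct)
      (simp_all add: relations_mult_mon[OF assms] relations_0 relations_add relations_scale
        word_scale_mult distrib_left)
qed (simp_all add: relations_0 relations_add relations_scale word_scale_mult distrib_right)

lemma relations_mult_left: "p \<in> relations \<Longrightarrow> l * p \<in> relations"
  and relations_mult_right: "p \<in> relations \<Longrightarrow> p * l \<in> relations"
  using relations_mult[of p l 1] relations_mult[of p 1 l] by simp_all

lemma mon_minus_iota: "mon [a] - iota a \<in> relations"
proof (induct a rule: basis_induct)
  case 1
  \<comment> \<open>With both summands equal to 0 this relator is \<open>- mon [0]\<close>, so the
    letter 0 is itself a relation.\<close>
  have "mon ([] @ [0 + 0] @ []) - mon ([] @ [0] @ []) - mon ([] @ [0 :: 'g] @ []) \<in> relators"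
    unfolding relators_def by blast
  from relations_minus[OF relator_relations[OF this]] show ?case
    by (simp add: iota_0)
next
  case (2 a b)
  have "mon ([] @ [a + b] @ []) - mon ([] @ [a] @ []) - mon ([] @ [b] @ []) \<in> relators"
    unfolding relators_def by blast
  from relations_add[OF relations_add[OF relator_relations[OF this] 2(1)] 2(2)] show ?case
    by (simp add: iota_add algebra_simps)
next
  case (3 c a)
  have "mon ([] @ [scale c a] @ []) - word_scale c (mon ([] @ [a] @ [])) \<in> relators"
    unfolding relators_def by blast
  from relations_add[OF relator_relations[OF this] relations_scale[OF 3, of c]] show ?case
    by (simp add: iota_scale W.scale_right_diff_distrib)
qed (simp add: iota_basis relations_0)

lemma mon_minus_letters_product: "mon w - letters_product w \<in> relations"
proof (induct w)
  case Nil
  show ?case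
    by (simp add: mon_Nil letters_product_Nil relations_0)
next
  case (Cons a w)
  have "mon (a # w) - letters_product (a # w)
      = (mon [a] - iota a) * mon w + iota a * (mon w - letters_product w)"
    by (subst mon_Cons) (simp add: letters_product_Cons algebra_simps)
  also have "\<dots> \<in> relations"
    by (intro relations_add relations_mult_left relations_mult_right mon_minus_iota Cons)
  finally show ?case .
qed

lemma minus_lin_ext_relations:
  assumes "\<And>w. mon w - f w \<in> relations"
  shows "p - lin_ext f p \<in> relations"
proof (induct p rule: word_induct)
  case (2 p q)
  then show ?case
    using relations_add[of "p - lin_ext f p" "q - lin_ext f q"]
    by (simp add: lin_ext_add algebra_simps)
next
  case (3 c p)
  then show ?case
    using relations_scale[of "p - lin_ext f p" c] by (simp add: lin_ext_scale W.scale_right_diff_distrib)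
qed (simp_all add: assms relations_0 lin_ext_0)

lemma sigma_cases [case_names normal descent]:
  obtains "\<And>u x y v. w = u @ x # y # v \<Longrightarrow> \<not> gt x y" "sigma w = mon w"
  | u x y v where "w = u @ x # y # v" "gt x y"
    "sigma w = sigma (u @ y # x # v) + S (mon u * iota (bracket x y) * mon v)"
proof (cases "\<exists>u x y v. w = u @ x # y # v \<and> gt x y")
  case True
  then obtain u x y v where "w = u @ x # y # v" "gt x y" by blast
  then show thesis
    by (rule sigma_descent) (rule that(2))
next
  case False
  then show thesis
    using sigma_no_descent[of w] that(1) by blast
qed

text \<open>A rewriting step changes a word by a relator, except that the letter [x,y] must also be
  replaced by its expansion. The four members of \<open>relations\<close> collected in the proof
  telescope: swap, sort the swapped word, expand the bracket, sort the expansion.\<close>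

lemma mon_minus_sigma: "mon w - sigma w \<in> relations"
proof (induct w rule: wf_induct_rule[OF wf_measures[of "[length, inversions]"]])
  case (1 w)
  show ?case
  proof (cases w rule: sigma_cases)
    case normal
    then show ?thesis by (simp add: relations_0)
  next
    case (descent u x y v)
    let ?r = "mon (u @ [x, y] @ v) - mon (u @ [y, x] @ v) - mon (u @ [bracket x y] @ v)"
    have "?r \<in> relations"
      by (intro relator_relations) (unfold relators_def, blast)
    moreover have "mon (u @ y # x # v) - sigma (u @ y # x # v) \<in> relations"
      using inversions_swap[OF descent(2)] by (intro 1) (simp add: descent(1))
    moreover have "mon u * (mon [bracket x y] - iota (bracket x y)) * mon v \<in> relations"
      by (intro relations_mult mon_minus_iota)
    moreover have "mon u * iota (bracket x y) * mon v - S (mon u * iota (bracket x y) * mon v) \<in> relations"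
    proof -
      let ?c = "coord (bracket x y)"
      have "mon u * iota (bracket x y) * mon v - S (mon u * iota (bracket x y) * mon v)
        = (\<Sum>z | ?c z \<noteq> 0. word_scale (?c z) (mon (u @ z # v) - sigma (u @ z # v)))"
        unfolding S_iota unfolding iota_def
        by (simp add: sum_distrib_left sum_distrib_right word_scale_mult W.scale_right_diff_distrib
            sum_subtractf mon_append_Cons)
      also have "\<dots> \<in> relations"
        by (intro relations_sum relations_scale 1) (simp add: descent(1))
      finally show ?thesis .
    qed
    ultimately have "?r + (mon (u @ y # x # v) - sigma (u @ y # x # v))
        + mon u * (mon [bracket x y] - iota (bracket x y)) * mon v
        + (mon u * iota (bracket x y) * mon v - S (mon u * iota (bracket x y) * mon v)) \<in> relations"
      by (intro relations_add)
    also have "?r + (mon (u @ y # x # v) - sigma (u @ y # x # v))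
        + mon u * (mon [bracket x y] - iota (bracket x y)) * mon v
        + (mon u * iota (bracket x y) * mon v - S (mon u * iota (bracket x y) * mon v))
        = mon w - sigma w"
      unfolding descent(3) by (simp add: descent(1) algebra_simps flip: mon_append)
    finally show ?thesis .
  qed
qed

lemma minus_normal_form_relations: "p - normal_form p \<in> relations"
  using relations_add[OF minus_lin_ext_relations[OF mon_minus_letters_product, of p]
      minus_lin_ext_relations[OF mon_minus_sigma, of "expand p"]]
  by (simp add: normal_form_def)

lemma normal_form_eq_iff: "normal_form p = normal_form q \<longleftrightarrow> p - q \<in> relations"
proof
  assume "normal_form p = normal_form q"
  then show "p - q \<in> relations"
    using relations_diff[OF minus_normal_form_relations[of p] minus_normal_form_relations[of q]]
    by simp
next
  assume "p - q \<in> relations"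
  from normal_form_relations[OF this] show "normal_form p = normal_form q"
    by (simp add: WW.linear_diff[OF word_linear_normal_form])
qed

section \<open>Support in the canonical words\<close>

abbreviation words_in :: "'g list set \<Rightarrow> ('g list \<Rightarrow>\<^sub>0 'k) set" where
  "words_in A \<equiv> {p. Poly_Mapping.keys p \<subseteq> A}"

lemma words_in_add: "p \<in> words_in A \<Longrightarrow> q \<in> words_in A \<Longrightarrow> p + q \<in> words_in A"
  using keys_add[of p q] by auto

lemma words_in_scale: "p \<in> words_in A \<Longrightarrow> word_scale c p \<in> words_in A"
  by (auto simp: in_keys_iff lookup_word_scale)

lemma words_in_sum: "(\<And>i. i \<in> I \<Longrightarrow> f i \<in> words_in A) \<Longrightarrow> sum f I \<in> words_in A"
proof (induct I rule: infinite_finite_induct)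
  case (insert i I)
  then show ?case
    using words_in_add[of "f i" A "sum f I"] by simp
qed simp_all

lemma words_in_lin_ext:
  assumes "\<And>w. w \<in> Poly_Mapping.keys p \<Longrightarrow> f w \<in> words_in A"
  shows "lin_ext f p \<in> words_in A"
  unfolding lin_ext_def by (intro words_in_sum words_in_scale assms)

text \<open>By transitivity, sortedness can be tested on neighbours; thus canonical words are the
  words over \<open>B\<close> at which rewriting stops.\<close>

lemma canonical_word_iff:
  "w \<in> canonical_words B r \<longleftrightarrow> set w \<subseteq> B \<and> (\<forall>u x y v. w = u @ x # y # v \<longrightarrow> \<not> gt x y)"
proof (intro iffI conjI allI impI; (elim conjE)?)
  fix u x y v
  assume "w \<in> canonical_words B r" "w = u @ x # y # v"
  then show "\<not> gt x y"
    by (auto simp: canonical_words_def sorted_wrt_append rel_iff_not_gt)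
next
  assume "set w \<subseteq> B" "\<forall>u x y v. w = u @ x # y # v \<longrightarrow> \<not> gt x y"
  then show "w \<in> canonical_words B r"
  proof (induct w)
    case (Cons x w)
    have "\<forall>u x y v. w = u @ x # y # v \<longrightarrow> \<not> gt x y"
      using Cons(3) by (metis append_Cons)
    with Cons have w: "w \<in> canonical_words B r" by simp
    show ?case
    proof (cases w)
      case (Cons y v)
      have "\<not> gt x y"
        using Cons.prems(2) \<open>w = y # v\<close> by (metis append_Nil)
      then have "(x, y) \<in> r"
        using Cons.prems(1) \<open>w = y # v\<close> by (simp add: rel_iff_not_gt)
      moreover have "trans r"
        using order by (simp add: linear_order_on_def partial_order_on_def preorder_on_def)
      ultimately show ?thesis
        using w Cons.prems(1) \<open>w = y # v\<close> by (auto simp: canonical_words_def dest: transD)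
    qed (use Cons.prems in \<open>auto simp: canonical_words_def\<close>)
  qed (simp add: canonical_words_def)
qed (auto simp: canonical_words_def)

lemma sigma_words_in: "set w \<subseteq> B \<Longrightarrow> sigma w \<in> words_in (canonical_words B r)"
proof (induct w rule: wf_induct_rule[OF wf_measures[of "[length, inversions]"]])
  case (1 w)
  show ?case
  proof (cases w rule: sigma_cases)
    case normal
    then show ?thesis
      using 1(2) by (simp add: canonical_word_iff)
  next
    case (descent u x y v)
    have "sigma (u @ y # x # v) \<in> words_in (canonical_words B r)"
      using inversions_swap[OF descent(2)] 1(2) by (intro 1(1)) (simp_all add: descent(1))
    moreover have "z \<in> B" if "coord (bracket x y) z \<noteq> 0" for z
      using that representation_ne_zero by blast
    then have "S (mon u * iota (bracket x y) * mon v) \<in> words_in (canonical_words B r)"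
      unfolding S_iota using 1(2) by (intro words_in_sum words_in_scale 1(1)) (simp_all add: descent(1))
    ultimately show ?thesis
      unfolding descent(3) by (rule words_in_add)
  qed
qed

lemma letters_product_words_in: "letters_product w \<in> words_in {v. set v \<subseteq> B}"
proof (induct w)
  case (Cons a w)
  have "iota a \<in> words_in {v. set v \<subseteq> B}"
    unfolding iota_def by (intro words_in_sum words_in_scale) (auto dest: representation_ne_zero)
  then show ?case
    using Cons keys_mult[of "iota a" "letters_product w"]
    by (force simp: letters_product_Cons plus_list_def)
qed (simp add: letters_product_Nil zero_list_def)

lemma keys_normal_form: "Poly_Mapping.keys (normal_form p) \<subseteq> canonical_words B r"
proof -
  have "expand p \<in> words_in {v. set v \<subseteq> B}"
    by (intro words_in_lin_ext letters_product_words_in)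
  then have "S (expand p) \<in> words_in (canonical_words B r)"
    by (intro words_in_lin_ext sigma_words_in) auto
  then show ?thesis
    by (simp add: normal_form_def)
qed

lemma letters_product_basis: "set w \<subseteq> B \<Longrightarrow> letters_product w = mon w"
proof (induct w)
  case (Cons a w)
  then show ?case
    by (subst mon_Cons) (simp add: letters_product_Cons iota_basis)
qed (simp add: letters_product_Nil mon_Nil)

lemma normal_form_canonical:
  assumes "Poly_Mapping.keys p \<subseteq> canonical_words B r"
  shows "normal_form p = p"
proof (rule word_linear_eqI[OF word_linear_normal_form])
  show "word_linear (\<lambda>p. p)"
    by (rule word_linearI) auto
  fix w assume "w \<in> Poly_Mapping.keys p"
  with assms have "w \<in> canonical_words B r" by blast
  moreover from this have "sigma w = mon w"
    by (intro sigma_no_descent) (meson canonical_word_iff)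
  ultimately show "normal_form (mon w) = mon w"
    by (simp add: normal_form_def canonical_word_iff letters_product_basis)
qed

end

section \<open>The tensor algebra as a quotient of the algebra of words\<close>

definition component :: "nat \<Rightarrow> ('g list \<Rightarrow>\<^sub>0 'k::field) \<Rightarrow> ('g list \<Rightarrow>\<^sub>0 'k)" where
  "component n = lin_ext (\<lambda>w. if length w = n then mon w else 0)"

definition homogeneous :: "nat \<Rightarrow> ('g list \<Rightarrow>\<^sub>0 'k::field) \<Rightarrow> bool" where
  "homogeneous n p \<longleftrightarrow> (\<forall>w\<in>Poly_Mapping.keys p. length w = n)"

lemma word_linear_component: "word_linear (component n)"
  unfolding component_def by (rule word_linear_lin_ext)

lemma component_mon: "component n (mon w) = (if length w = n then mon w else 0)"
  by (simp add: component_def)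

lemma component_add: "component n (p + q) = component n p + component n q"
  and component_diff: "component n (p - q) = component n p - component n q"
  and component_scale: "component n (word_scale c p) = word_scale c (component n p)"
  and component_0: "component n 0 = 0"
  and component_sum: "component n (sum f A) = (\<Sum>i\<in>A. component n (f i))"
  unfolding component_def by (rule lin_ext_add lin_ext_diff lin_ext_scale lin_ext_0 lin_ext_sum)+

lemma component_homogeneous:
  assumes "homogeneous n p"
  shows "component m p = (if m = n then p else 0)"
proof (cases "m = n")
  case True
  have "component n p = (\<lambda>p. p) p"
    by (rule word_linear_eqI[OF word_linear_component word_linearI])
      (use assms in \<open>auto simp: component_mon homogeneous_def\<close>)
  with True show ?thesis by simp
next
  case False
  have "component m p = (\<lambda>p. 0) p"
    by (rule word_linear_eqI[OF word_linear_component word_linearI])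
      (use assms False in \<open>auto simp: component_mon homogeneous_def\<close>)
  with False show ?thesis by simp
qed

lemma homogeneous_0: "homogeneous n 0"
  and homogeneous_mon: "length w = n \<Longrightarrow> homogeneous n (mon w)"
  by (auto simp: homogeneous_def)

lemma homogeneous_add: "homogeneous n p \<Longrightarrow> homogeneous n q \<Longrightarrow> homogeneous n (p + q)"
  using keys_add[of p q] by (auto simp: homogeneous_def)

lemma homogeneous_scale: "homogeneous n p \<Longrightarrow> homogeneous n (word_scale c p)"
  by (auto simp: homogeneous_def in_keys_iff lookup_word_scale)

lemma homogeneous_component: "homogeneous n (component n p)"
  by (induct p rule: word_induct)
    (simp_all add: component_0 component_add component_scale component_mon
      homogeneous_0 homogeneous_add homogeneous_scale homogeneous_mon)

lemma homogeneous_diff: "homogeneous n p \<Longrightarrow> homogeneous n q \<Longrightarrow> homogeneous n (p - q)"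
  using homogeneous_add[of n p "word_scale (-1) q"] homogeneous_scale[of n q "-1"] by simp

lemma sum_components:
  assumes "finite N" "length ` Poly_Mapping.keys p \<subseteq> N"
  shows "(\<Sum>n\<in>N. component n p) = p"
proof -
  have "word_linear (\<lambda>p. \<Sum>n\<in>N. component n p)"
    by (rule word_linearI) (simp_all add: component_add component_scale sum.distrib W.scale_sum_right)
  moreover have "word_linear (\<lambda>p. p)"
    by (rule word_linearI) simp_all
  ultimately show ?thesis
    by (rule word_linear_eqI) (use assms in \<open>auto simp: component_mon\<close>)
qed

text \<open>This is the convolution in the product of \<open>tensor_algebra\<close>, and hence the
  reason why \<open>tensor\<close> is multiplicative.\<close>

lemma component_mult: "component n (p * q) = (\<Sum>i\<le>n. component i p * component (n - i) q)"
proof (induct p rule: word_induct)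
  case (4 u)
  show ?case
  proof (induct q rule: word_induct)
    case (4 v)
    have "(\<Sum>i\<le>n. component i (mon u) * component (n - i) (mon v))
        = (\<Sum>i\<le>n. if i = length u then mon u * component (n - i) (mon v) else 0)"
      by (intro sum.cong) (auto simp: component_mon)
    also have "\<dots> = component n (mon (u @ v))"
      by (auto simp: component_mon simp flip: mon_append)
    finally show ?case
      unfolding mon_append by (rule sym)
  qed (simp_all add: component_0 component_add component_scale distrib_left sum.distrib
      word_scale_mult W.scale_sum_right)
qed (simp_all add: component_0 component_add component_scale distrib_right sum.distrib
      word_scale_mult W.scale_sum_right)

context
  fixes scale :: "'k::field \<Rightarrow> 'g::ab_group_add \<Rightarrow> 'g"
begin

section \<open>Multilinear relations in each degree and their cosets\<close>

abbreviation R :: "nat \<Rightarrow> ('g list \<Rightarrow>\<^sub>0 'k) set" where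
  "R \<equiv> multilinear_relations scale"

definition multilinear_relators :: "nat \<Rightarrow> ('g list \<Rightarrow>\<^sub>0 'k) set" where
  "multilinear_relators n = {mon (u @ [a + b] @ v) - mon (u @ [a] @ v) - mon (u @ [b] @ v)
      | u v a b. length u + 1 + length v = n} \<union>
     {mon (u @ [scale c a] @ v) - word_scale c (mon (u @ [a] @ v))
      | u v c a. length u + 1 + length v = n}"

lemma multilinear_relations_eq: "R n = W.span (multilinear_relators n)"
  unfolding multilinear_relations_def multilinear_relators_def ..

lemma multilinear_relators_cases [consumes 1, case_names add scale]:
  assumes "p \<in> multilinear_relators n"
  obtains u v a b where "p = mon (u @ [a + b] @ v) - mon (u @ [a] @ v) - mon (u @ [b] @ v)"
    "length u + 1 + length v = n"
  | u v c a where "p = mon (u @ [scale c a] @ v) - word_scale c (mon (u @ [a] @ v))"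
    "length u + 1 + length v = n"
  using assms unfolding multilinear_relators_def by blast

lemma R_0: "0 \<in> R n"
  and R_add: "p \<in> R n \<Longrightarrow> q \<in> R n \<Longrightarrow> p + q \<in> R n"
  and R_diff: "p \<in> R n \<Longrightarrow> q \<in> R n \<Longrightarrow> p - q \<in> R n"
  and R_scale: "p \<in> R n \<Longrightarrow> word_scale c p \<in> R n"
  unfolding multilinear_relations_eq
  by (simp_all add: W.span_zero W.span_add W.span_diff W.span_scale)

lemma R_induct [consumes 1, case_names 0 add scale relator]:
  assumes "p \<in> R n" "P 0" "\<And>p q. P p \<Longrightarrow> P q \<Longrightarrow> P (p + q)" "\<And>c p. P p \<Longrightarrow> P (word_scale c p)"
    "\<And>p. p \<in> multilinear_relators n \<Longrightarrow> P p"
  shows "P p"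
  by (rule W.span_induct_alt[OF assms(1)[unfolded multilinear_relations_eq]]) (auto intro: assms)

lemma R_homogeneous: "p \<in> R n \<Longrightarrow> homogeneous n p"
proof (induct p rule: R_induct)
  case (relator p)
  then show ?case
    by (cases p rule: multilinear_relators_cases)
      (auto intro!: homogeneous_diff homogeneous_scale homogeneous_mon)
qed (auto intro: homogeneous_0 homogeneous_add homogeneous_scale)

lemma R_mult_mon:
  assumes "p \<in> R n"
  shows "mon l * p * mon q \<in> R (length l + n + length q)"
  using assms
proof (induct p rule: R_induct)
  case (relator p)
  have "mon l * p * mon q \<in> multilinear_relators (length l + n + length q)"
    using relator
  proof (cases p rule: multilinear_relators_cases)
    case (add u v a b)
    have "mon l * p * mon q = mon ((l @ u) @ [a + b] @ v @ q) - mon ((l @ u) @ [a] @ v @ q)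
        - mon ((l @ u) @ [b] @ v @ q)"
      by (simp add: add algebra_simps flip: mon_append)
    moreover have "length (l @ u) + 1 + length (v @ q) = length l + n + length q"
      using add(2) by simp
    ultimately show ?thesis
      unfolding multilinear_relators_def by blast
  next
    case (scale u v c a)
    have "mon l * p * mon q = mon ((l @ u) @ [scale c a] @ v @ q)
        - word_scale c (mon ((l @ u) @ [a] @ v @ q))"
      by (simp add: scale algebra_simps word_scale_mult flip: mon_append)
    moreover have "length (l @ u) + 1 + length (v @ q) = length l + n + length q"
      using scale(2) by simp
    ultimately show ?thesis
      unfolding multilinear_relators_def by blast
  qed
  then show ?case
    unfolding multilinear_relations_eq by (rule W.span_base)
qed (simp_all add: R_0 R_add R_scale word_scale_mult algebra_simps)

lemma R_mult_left:
  assumes "homogeneous i p" "q \<in> R j"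
  shows "p * q \<in> R (i + j)"
proof (induct p rule: word_induct)
  case (4 w)
  then show ?case
    using assms(1) R_mult_mon[OF assms(2), of w "[]"] by (simp add: homogeneous_def mon_Nil)
qed (simp_all add: R_0 R_add R_scale word_scale_mult distrib_right)

lemma R_mult_right:
  assumes "p \<in> R i" "homogeneous j q"
  shows "p * q \<in> R (i + j)"
proof (induct q rule: word_induct)
  case (4 w)
  then show ?case
    using assms(2) R_mult_mon[OF assms(1), of "[]" w] by (simp add: homogeneous_def mon_Nil)
qed (simp_all add: R_0 R_add R_scale word_scale_mult distrib_left)

lemma mem_coset_R: "x \<in> p +o R n \<longleftrightarrow> x - p \<in> R n"
  unfolding elt_set_plus_def by (auto intro: bexI[of _ "x - p"])

lemma coset_R_eq_iff: "p +o R n = q +o R n \<longleftrightarrow> p - q \<in> R n"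
proof
  assume "p +o R n = q +o R n"
  then show "p - q \<in> R n"
    using mem_coset_R[of p p n] mem_coset_R[of p q n] R_0 by auto
next
  assume *: "p - q \<in> R n"
  have "x - p \<in> R n \<longleftrightarrow> x - q \<in> R n" for x
    using R_add[OF _ *, of "x - p"] R_diff[OF _ *, of "x - q"] by auto
  then show "p +o R n = q +o R n"
    by (auto simp: mem_coset_R)
qed

lemma R_plus_R: "R n + R n = R n"
  unfolding set_plus_def by (auto intro: R_add) (use R_0 in force)

lemma coset_R_add: "(p +o R n) + (q +o R n) = (p + q) +o R n"
  by (simp add: set_plus_rearrange R_plus_R)

lemma coset_R_sum: "(\<Sum>i\<le>m. f i +o R n) = (\<Sum>i\<le>m. f i) +o R n" for m :: nat
  by (induct m) (simp_all add: coset_R_add)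

text \<open>Elementwise products differ from \<open>p * q\<close> by relations and include
  \<open>p * q\<close> itself, so adding \<open>R (i + j)\<close> fills the coset. Homogeneity puts
  the mixed terms into degree \<open>i + j\<close>.\<close>

lemma coset_R_mult:
  assumes "homogeneous i p" "homogeneous j q"
  shows "(p +o R i) * (q +o R j) + R (i + j) = (p * q) +o R (i + j)"
proof (intro equalityI subsetI)
  fix x assume "x \<in> (p +o R i) * (q +o R j) + R (i + j)"
  then obtain a b c where x: "x = a * b + c" "a - p \<in> R i" "b - q \<in> R j" "c \<in> R (i + j)"
    by (auto simp: set_plus_def set_times_def mem_coset_R)
  have "x - p * q = (a - p) * (b - q) + (a - p) * q + p * (b - q) + c"
    by (simp add: x(1) algebra_simps)
  also have "\<dots> \<in> R (i + j)"
    using x assms by (intro R_add R_mult_left R_mult_right) (auto dest: R_homogeneous)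
  finally show "x \<in> (p * q) +o R (i + j)"
    by (simp add: mem_coset_R)
next
  fix x assume "x \<in> (p * q) +o R (i + j)"
  then have "x = p * q + (x - p * q)" "x - p * q \<in> R (i + j)"
    by (simp_all add: mem_coset_R)
  moreover have "p * q \<in> (p +o R i) * (q +o R j)"
    by (intro set_times_intro) (simp_all add: mem_coset_R R_0)
  ultimately show "x \<in> (p +o R i) * (q +o R j) + R (i + j)"
    by (metis set_plus_intro)
qed

lemma coset_R_scale: "word_scale c ` (p +o R n) + R n = word_scale c p +o R n"
proof (intro equalityI subsetI)
  fix x assume "x \<in> word_scale c ` (p +o R n) + R n"
  then obtain a b where x: "x = word_scale c a + b" "a - p \<in> R n" "b \<in> R n"
    by (auto simp: set_plus_def mem_coset_R)
  then show "x \<in> word_scale c p +o R n"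
    using R_add[OF R_scale[OF x(2), of c] x(3)]
    by (simp add: mem_coset_R W.scale_right_diff_distrib algebra_simps)
next
  fix x assume "x \<in> word_scale c p +o R n"
  then have "x = word_scale c p + (x - word_scale c p)" "x - word_scale c p \<in> R n"
    by (simp_all add: mem_coset_R)
  moreover have "word_scale c p \<in> word_scale c ` (p +o R n)"
    by (intro imageI) (simp add: mem_coset_R R_0)
  ultimately show "x \<in> word_scale c ` (p +o R n) + R n"
    by (metis set_plus_intro)
qed

lemma zero_coset_R: "0 +o R n = R n"
  by (auto simp: mem_coset_R)

section \<open>The quotient map from words onto the tensor algebra\<close>

definition tensor :: "('g list \<Rightarrow>\<^sub>0 'k) \<Rightarrow> nat \<Rightarrow> ('g list \<Rightarrow>\<^sub>0 'k) set" where
  "tensor p = (\<lambda>n. component n p +o R n)"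

abbreviation T :: "('k, nat \<Rightarrow> ('g list \<Rightarrow>\<^sub>0 'k) set) module" where
  "T \<equiv> tensor_algebra scale"

lemma tensor_eq_iff: "tensor p = tensor q \<longleftrightarrow> (\<forall>n. component n (p - q) \<in> R n)"
  unfolding tensor_def fun_eq_iff coset_R_eq_iff component_diff ..

text \<open>Finite support allows homogeneous representatives of all cosets to be added up to one
  element whose components give the cosets back.\<close>

lemma carrier_T: "carrier T = range tensor"
proof (intro equalityI subsetI)
  fix t assume "t \<in> carrier T"
  then have pow: "t n \<in> tensor_power scale n" and fin: "finite {n. t n \<noteq> R n}" for n
    by (auto simp: tensor_algebra_def)
  \<comment> \<open>Taking the representative 0 for a trivial coset makes the sum over the other
    degrees have the prescribed component in every degree.\<close>
  have "\<exists>p. t n = p +o R n \<and> homogeneous n p \<and> (t n = R n \<longrightarrow> p = 0)" for n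
  proof (cases "t n = R n")
    case True
    then show ?thesis
      by (intro exI[of _ 0]) (simp add: zero_coset_R homogeneous_0)
  next
    case False
    then show ?thesis
      using pow[of n] by (auto simp: tensor_power_def homogeneous_def)
  qed
  then obtain f where f: "\<And>n. t n = f n +o R n" "\<And>n. homogeneous n (f n)" "\<And>n. t n = R n \<Longrightarrow> f n = 0"
    by metis
  have "component n (\<Sum>m | t m \<noteq> R m. f m) = f n" for n
  proof -
    have "component n (\<Sum>m | t m \<noteq> R m. f m) = (\<Sum>m | t m \<noteq> R m. if n = m then f m else 0)"
      unfolding component_sum by (intro sum.cong refl component_homogeneous f)
    also have "\<dots> = f n"
      using fin f(3)[of n] by (simp add: sum.delta')
    finally show ?thesis .
  qed
  then have "t = tensor (\<Sum>m | t m \<noteq> R m. f m)"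
    by (simp add: tensor_def fun_eq_iff f(1))
  then show "t \<in> range tensor"
    by blast
next
  fix t assume "t \<in> range tensor"
  then obtain p where t: "t = tensor p" by blast
  have "t n \<in> tensor_power scale n" for n
    using homogeneous_component[of n p] unfolding tensor_power_def t tensor_def homogeneous_def by blast
  moreover have "component n p = 0" if "n \<notin> length ` Poly_Mapping.keys p" for n
  proof -
    have "component n p = (\<Sum>w\<in>Poly_Mapping.keys p. 0)"
      unfolding component_def lin_ext_def by (rule sum.cong) (use that in auto)
    then show ?thesis by simp
  qed
  then have "{n. t n \<noteq> R n} \<subseteq> length ` Poly_Mapping.keys p"
    by (auto simp: t tensor_def zero_coset_R)
  then have "finite {n. t n \<noteq> R n}"
    by (rule finite_subset) simp
  ultimately show "t \<in> carrier T"
    by (simp add: tensor_algebra_def)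
qed

lemma tensor_closed: "tensor p \<in> carrier T"
  by (simp add: carrier_T)

lemma add_T: "tensor p \<oplus>\<^bsub>T\<^esub> tensor q = tensor (p + q)"
  by (simp add: tensor_algebra_def tensor_def coset_R_add component_add)

lemma zero_T: "\<zero>\<^bsub>T\<^esub> = tensor 0"
  by (simp add: tensor_algebra_def tensor_def component_0 zero_coset_R)

lemma one_T: "\<one>\<^bsub>T\<^esub> = tensor 1"
  using component_mon[of _ "[] :: 'g list", where ?'b = 'k]
  by (auto simp: tensor_algebra_def tensor_def mon_Nil fun_eq_iff)

lemma smult_T: "c \<odot>\<^bsub>T\<^esub> tensor p = tensor (word_scale c p)"
  by (simp add: tensor_algebra_def tensor_def coset_R_scale component_scale)

lemma mult_T: "tensor p \<otimes>\<^bsub>T\<^esub> tensor q = tensor (p * q)"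
proof
  fix n
  have "(tensor p \<otimes>\<^bsub>T\<^esub> tensor q) n
      = (\<Sum>i\<le>n. (component i p +o R i) * (component (n - i) q +o R (n - i)) + R n)"
    by (simp add: tensor_algebra_def tensor_def)
  also have "\<dots> = (\<Sum>i\<le>n. (component i p * component (n - i) q) +o R n)"
  proof (rule sum.cong)
    fix i assume "i \<in> {..n}"
    then show "(component i p +o R i) * (component (n - i) q +o R (n - i)) + R n
        = (component i p * component (n - i) q) +o R n"
      using coset_R_mult[OF homogeneous_component[of i p] homogeneous_component[of "n - i" q]] by simp
  qed simp
  also have "\<dots> = tensor (p * q) n"
    by (simp add: coset_R_sum tensor_def component_mult)
  finally show "(tensor p \<otimes>\<^bsub>T\<^esub> tensor q) n = tensor (p * q) n" .
qed

lemma pure_tensor_eq: "pure_tensor scale w = tensor (mon w)"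
  by (auto simp: pure_tensor_def tensor_def component_mon fun_eq_iff)

lemma ring_T: "ring T"
proof (rule ringI)
  show "abelian_group T"
  proof (rule abelian_groupI)
    fix x assume "x \<in> carrier T"
    then obtain p where "x = tensor p"
      by (auto simp: carrier_T)
    then show "\<exists>y\<in>carrier T. y \<oplus>\<^bsub>T\<^esub> x = \<zero>\<^bsub>T\<^esub>"
      by (intro bexI[of _ "tensor (- p)"]) (simp_all add: add_T zero_T tensor_closed)
  qed (auto simp: carrier_T add_T zero_T ac_simps)
  show "monoid T"
    by (rule monoidI) (auto simp: carrier_T mult_T one_T mult.assoc)
qed (auto simp: carrier_T add_T mult_T distrib_left distrib_right)

lemma minus_T: "tensor p \<ominus>\<^bsub>T\<^esub> tensor q = tensor (p - q)"
proof -
  interpret ring T by (rule ring_T)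
  have "\<ominus>\<^bsub>T\<^esub> tensor q = tensor (- q)"
    by (rule minus_equality) (simp_all add: add_T zero_T tensor_closed)
  then show ?thesis
    by (simp add: a_minus_def add_T)
qed

end

section \<open>The enveloping algebra\<close>

context pbw
begin

abbreviation TA :: "('k, nat \<Rightarrow> ('g list \<Rightarrow>\<^sub>0 'k) set) module" where
  "TA \<equiv> tensor_algebra scale"

abbreviation L :: "(nat \<Rightarrow> ('g list \<Rightarrow>\<^sub>0 'k) set) set" where
  "L \<equiv> lie_ideal scale bracket"

abbreviation UA :: "('k, (nat \<Rightarrow> ('g list \<Rightarrow>\<^sub>0 'k) set) set) module" where
  "UA \<equiv> enveloping_algebra scale bracket"

section \<open>The defining ideal described by words\<close>

lemma multilinear_relations_subset: "multilinear_relations scale n \<subseteq> relations"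
  unfolding multilinear_relations_eq relations_def
  by (rule W.span_mono) (unfold multilinear_relators_def relators_def, blast)

lemma tensor_eqD:
  assumes "tensor scale p = tensor scale q"
  shows "p - q \<in> relations"
proof -
  have "(\<Sum>n\<in>length ` Poly_Mapping.keys (p - q). component n (p - q)) \<in> relations"
    using assms multilinear_relations_subset unfolding tensor_eq_iff by (intro relations_sum) blast
  then show ?thesis
    by (simp add: sum_components)
qed

lemma tensor_multilinear_relation:
  assumes "p \<in> multilinear_relators scale n"
  shows "tensor scale p = tensor scale 0"
proof -
  have p: "p \<in> multilinear_relations scale n"
    unfolding multilinear_relations_eq using assms by (rule W.span_base)
  then show ?thesis
    by (simp add: tensor_eq_iff component_homogeneous[OF R_homogeneous[OF p]] R_0)
qed

lemma lie_ideal_eq: "L = genideal TA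
    {tensor scale (mon [a, b] - mon [b, a] - mon [bracket a b]) | a b. True}"
  unfolding lie_ideal_def pure_tensor_eq minus_T ..

lemma ideal_lie_ideal: "ideal L TA"
  unfolding lie_ideal_eq
  by (rule ring.genideal_ideal[OF ring_T]) (auto simp: tensor_closed)

text \<open>Linearity relators are already zero in the tensor algebra, and a bracket relator is a
  generator of the ideal multiplied by the images of \<open>u\<close> and \<open>v\<close>.\<close>

lemma tensor_in_lie_ideal:
  assumes "p \<in> relations"
  shows "tensor scale p \<in> L"
proof -
  interpret ideal L TA by (rule ideal_lie_ideal)
  have zero: "tensor scale 0 \<in> L"
    using additive_subgroup.zero_closed[OF is_additive_subgroup] by (simp add: zero_T)
  have multilinear: "tensor scale p \<in> L" if "p \<in> multilinear_relators scale n" for p n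
    using zero by (simp add: tensor_multilinear_relation[OF that])
  show ?thesis
    using assms
  proof (induct p rule: relations_induct)
    case (add p q)
    then show ?case
      using additive_subgroup.a_closed[OF is_additive_subgroup, of "tensor scale p" "tensor scale q"]
      by (simp add: add_T)
  next
    case (scale c p)
    \<comment> \<open>An ideal of a ring is closed under products only, so the scalar is realised as
      a multiple of the empty word.\<close>
    then show ?case
      using I_l_closed[OF scale tensor_closed[of scale "Poly_Mapping.single [] c"]]
      by (simp add: mult_T word_scale_eq_mult)
  next
    case (relator p)
    then show ?case
    proof (cases p rule: relators_cases)
      case (add u v a b)
      then have "p \<in> multilinear_relators scale (length u + 1 + length v)"
        unfolding multilinear_relators_def by blast
      then show ?thesis
        by (rule multilinear)
    next
      case (scale u v c a)
      then have "p \<in> multilinear_relators scale (length u + 1 + length v)"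
        unfolding multilinear_relators_def by blast
      then show ?thesis
        by (rule multilinear)
    next
      case (bracket u v a b)
      have "tensor scale (mon [a, b] - mon [b, a] - mon [bracket a b]) \<in> L"
        unfolding lie_ideal_eq
        by (rule subsetD[OF ring.genideal_self[OF ring_T]]) (auto simp: tensor_closed)
      from I_r_closed[OF I_l_closed[OF this tensor_closed[of scale "mon u"]] tensor_closed[of scale "mon v"]]
      show ?thesis
        by (simp add: mult_T bracket left_diff_distrib right_diff_distrib flip: mon_append)
    qed
  qed (rule zero)
qed

lemma ideal_tensor_relations: "ideal (tensor scale ` relations) TA"
proof (rule idealI)
  interpret ring TA by (rule ring_T)
  show "subgroup (tensor scale ` relations) (add_monoid TA)"
  proof (rule add.subgroupI)
    show "\<ominus>\<^bsub>TA\<^esub> a \<in> tensor scale ` relations" if "a \<in> tensor scale ` relations" for a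
    proof -
      obtain p where "a = tensor scale p" "p \<in> relations" using \<open>a \<in> _\<close> by blast
      moreover have "\<ominus>\<^bsub>TA\<^esub> tensor scale p = tensor scale (- p)"
        by (rule minus_equality) (simp_all add: add_T zero_T tensor_closed)
      ultimately show ?thesis
        by (simp add: relations_minus)
    qed
    show "a \<oplus>\<^bsub>TA\<^esub> b \<in> tensor scale ` relations"
      if "a \<in> tensor scale ` relations" "b \<in> tensor scale ` relations" for a b
      using that by (auto simp: add_T intro!: imageI relations_add)
  qed (use relations_0 in \<open>auto simp: tensor_closed\<close>)
qed (auto simp: ring_T carrier_T mult_T intro: imageI[OF relations_mult_left] imageI[OF relations_mult_right])

text \<open>The image of \<open>relations\<close> is an ideal containing the generators, so it
  contains \<open>L\<close> by minimality. A preimage is determined only up to multilinear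
  relations, but these lie in \<open>relations\<close> as well.\<close>

lemma tensor_in_lie_ideal_iff: "tensor scale p \<in> L \<longleftrightarrow> p \<in> relations"
proof
  have "mon [a, b] - mon [b, a] - mon [bracket a b] \<in> relators" for a b
  proof -
    have "mon ([] @ [a, b] @ []) - mon ([] @ [b, a] @ []) - mon ([] @ [bracket a b] @ []) \<in> relators"
      unfolding relators_def by blast
    then show ?thesis by simp
  qed
  then have "L \<subseteq> tensor scale ` relations"
    unfolding lie_ideal_eq
    by (intro ring.genideal_minimal[OF ring_T ideal_tensor_relations]) (auto intro: relator_relations)
  moreover assume "tensor scale p \<in> L"
  ultimately obtain q where q: "tensor scale p = tensor scale q" "q \<in> relations"
    by blast
  show "p \<in> relations"
    using relations_add[OF tensor_eqD[OF q(1)] q(2)] by simp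
qed (rule tensor_in_lie_ideal)

section \<open>Residue classes and the operations of the enveloping algebra\<close>

definition cls :: "('g list \<Rightarrow>\<^sub>0 'k) \<Rightarrow> (nat \<Rightarrow> ('g list \<Rightarrow>\<^sub>0 'k) set) set" where
  "cls p = L +>\<^bsub>TA\<^esub> tensor scale p"

lemma tensor_in_cls: "tensor scale q \<in> cls p \<longleftrightarrow> q - p \<in> relations"
proof
  interpret ideal L TA by (rule ideal_lie_ideal)
  {
    assume "tensor scale q \<in> cls p"
    then obtain x where x: "x \<in> L" "tensor scale q = x \<oplus>\<^bsub>TA\<^esub> tensor scale p"
      unfolding cls_def a_r_coset_def' by auto
    moreover obtain l where "x = tensor scale l"
      using a_subset x(1) by (auto simp: carrier_T)
    ultimately have l: "l \<in> relations" "tensor scale q = tensor scale (l + p)"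
      by (simp_all add: tensor_in_lie_ideal_iff add_T)
    then show "q - p \<in> relations"
      using relations_add[OF tensor_eqD[OF l(2)] l(1)] by simp
  }
  assume "q - p \<in> relations"
  then have "tensor scale (q - p) \<oplus>\<^bsub>TA\<^esub> tensor scale p \<in> cls p"
    unfolding cls_def by (intro a_rcosI) (auto simp: tensor_in_lie_ideal_iff tensor_closed)
  then show "tensor scale q \<in> cls p"
    by (simp add: add_T)
qed

lemma cls_eq_iff: "cls p = cls q \<longleftrightarrow> p - q \<in> relations"
proof
  assume "cls p = cls q"
  then show "p - q \<in> relations"
    using tensor_in_cls[of p p] tensor_in_cls[of p q] by (simp add: relations_0)
next
  interpret ideal L TA by (rule ideal_lie_ideal)
  assume "p - q \<in> relations"
  then have "tensor scale p \<in> L +>\<^bsub>TA\<^esub> tensor scale q"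
    using tensor_in_cls[of p q] by (simp add: cls_def)
  from a_repr_independence'[OF this tensor_closed] show "cls p = cls q"
    by (simp add: cls_def)
qed

lemma cls_eq_iff_normal_form: "cls p = cls q \<longleftrightarrow> normal_form p = normal_form q"
  by (simp add: cls_eq_iff normal_form_eq_iff)

lemmas UA_simps = enveloping_algebra_def ring.defs module.defs FactRing_def

lemma carrier_UA: "carrier UA = range cls"
  by (auto simp: UA_simps A_RCOSETS_def' carrier_T cls_def)

lemma add_UA: "cls p \<oplus>\<^bsub>UA\<^esub> cls q = cls (p + q)"
proof -
  interpret ideal L TA by (rule ideal_lie_ideal)
  show ?thesis
    by (simp add: UA_simps cls_def a_rcos_sum tensor_closed add_T)
qed

lemma zero_UA: "\<zero>\<^bsub>UA\<^esub> = cls 0"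
proof -
  interpret ideal L TA by (rule ideal_lie_ideal)
  show ?thesis
    using a_coset_add_zero[OF a_subset] by (simp add: UA_simps cls_def flip: zero_T)
qed

lemma smult_UA: "c \<odot>\<^bsub>UA\<^esub> cls p = cls (word_scale c p)"
proof -
  interpret ideal L TA by (rule ideal_lie_ideal)
  \<comment> \<open>All cosets in the union that defines the scalar multiple coincide; as the union
    is over a nonempty set, it is that one coset.\<close>
  have "L +>\<^bsub>TA\<^esub> (c \<odot>\<^bsub>TA\<^esub> t) = cls (word_scale c p)" if t: "t \<in> cls p" for t
  proof -
    have "t \<in> carrier TA"
      using a_r_coset_subset_G[OF a_subset tensor_closed] t unfolding cls_def by blast
    then obtain q where q: "t = tensor scale q"
      by (auto simp: carrier_T)
    with t have "cls (word_scale c q) = cls (word_scale c p)"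
      using relations_scale[of "q - p" c] by (simp add: tensor_in_cls cls_eq_iff W.scale_right_diff_distrib)
    then show ?thesis
      by (simp add: q smult_T cls_def)
  qed
  moreover have "tensor scale p \<in> cls p"
    by (simp add: tensor_in_cls relations_0)
  ultimately show ?thesis
    by (auto simp: UA_simps)
qed

lemma word_class_eq: "word_class scale bracket w = cls (mon w)"
  by (simp add: word_class_def cls_def pure_tensor_eq)

lemma cls_closed: "cls p \<in> carrier UA"
  by (simp add: carrier_UA)

lemma abelian_group_UA: "abelian_group UA"
proof (rule abelian_groupI)
  fix x assume "x \<in> carrier UA"
  then obtain p where "x = cls p"
    by (auto simp: carrier_UA)
  then show "\<exists>y\<in>carrier UA. y \<oplus>\<^bsub>UA\<^esub> x = \<zero>\<^bsub>UA\<^esub>"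
    by (intro bexI[of _ "cls (- p)"]) (simp_all add: add_UA zero_UA cls_closed)
qed (auto simp: carrier_UA add_UA zero_UA ac_simps)

section \<open>Vector space structure and basis\<close>

lemma vectorspace_UA: "vectorspace class_ring UA"
proof (rule vectorspace.intro)
  show "module class_ring UA"
    by (rule moduleI[OF field.axioms(1)[OF class_field, THEN domain.axioms(1)] abelian_group_UA])
      (auto simp: carrier_UA add_UA smult_UA W.scale_left_distrib W.scale_right_distrib)
qed (rule class_field)

lemma finsum_UA: "finsum UA (\<lambda>i. cls (f i)) A = cls (sum f A)" if "finite A"
proof -
  interpret abelian_group UA by (rule abelian_group_UA)
  show ?thesis
    using that by (induct A) (simp_all add: zero_UA add_UA cls_closed)
qed

lemma finsum_word_class:
  "finsum UA (\<lambda>w. Poly_Mapping.lookup c w \<odot>\<^bsub>UA\<^esub> word_class scale bracket w) (Poly_Mapping.keys c) = cls c"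
  by (simp add: word_class_eq smult_UA finsum_UA poly_mapping_eq_sum_mon[symmetric])

text \<open>The sum is \<open>cls c\<close>, so the equation reads
  \<open>normal_form p = normal_form c\<close>; for \<open>c\<close> supported on canonical words
  the right side is \<open>c\<close>, which forces \<open>c = normal_form p\<close>.\<close>

lemma ex1_canonical:
  assumes "u \<in> carrier UA"
  shows "\<exists>!c. Poly_Mapping.keys c \<subseteq> canonical_words B r \<and>
    u = finsum UA (\<lambda>w. Poly_Mapping.lookup c w \<odot>\<^bsub>UA\<^esub> word_class scale bracket w) (Poly_Mapping.keys c)"
proof -
  obtain p where u: "u = cls p"
    using assms by (auto simp: carrier_UA)
  show ?thesis
    unfolding u finsum_word_class cls_eq_iff_normal_form
    by (rule ex1I[of _ "normal_form p"]) (auto simp: keys_normal_form normal_form_canonical subsetD)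
qed

lemma inj_on_word_class: "inj_on (word_class scale bracket) (canonical_words B r)"
proof (rule inj_onI)
  fix v w assume "v \<in> canonical_words B r" "w \<in> canonical_words B r"
    "word_class scale bracket v = word_class scale bracket w"
  then have "mon v = (mon w :: 'g list \<Rightarrow>\<^sub>0 'k)"
    by (simp add: word_class_eq cls_eq_iff_normal_form normal_form_canonical)
  from arg_cong[OF this, of Poly_Mapping.keys] show "v = w"
    by simp
qed

text \<open>Linear combinations run here over a set of vectors; injectivity of
  \<open>word_class\<close> translates their coefficients to and from coefficients indexed by
  words.\<close>

lemma basis_word_class:
  "vectorspace.basis class_ring UA (word_class scale bracket ` canonical_words B r)"
proof -
  interpret V: vectorspace class_ring UA by (rule vectorspace_UA)
  let ?C = "canonical_words B r"
  let ?wc = "word_class scale bracket"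
  have lincomb: "V.lincomb a (?wc ` A) = cls (\<Sum>w\<in>A. word_scale (a (?wc w)) (mon w))"
    if "finite A" "A \<subseteq> ?C" for a A
  proof -
    have "V.lincomb a (?wc ` A) = finsum UA (\<lambda>w. a (?wc w) \<odot>\<^bsub>UA\<^esub> ?wc w) A"
      unfolding V.lincomb_def using inj_on_subset[OF inj_on_word_class that(2)]
      by (intro V.M.add.finprod_reindex) (auto simp: word_class_eq smult_UA cls_closed)
    then show ?thesis
      by (simp add: word_class_eq smult_UA finsum_UA that(1))
  qed
  have "\<not> V.lin_dep (?wc ` ?C)"
  proof
    assume "V.lin_dep (?wc ` ?C)"
    then obtain A' a v where A': "finite A'" "A' \<subseteq> ?wc ` ?C" "V.lincomb a A' = \<zero>\<^bsub>UA\<^esub>" "v \<in> A'" "a v \<noteq> 0"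
      unfolding V.lin_dep_def by auto
    then obtain A where A: "A \<subseteq> ?C" "finite A" "A' = ?wc ` A"
      by (metis finite_subset_image)
    let ?c = "\<Sum>w\<in>A. word_scale (a (?wc w)) (mon w)"
    have lookup: "Poly_Mapping.lookup ?c w = (if w \<in> A then a (?wc w) else 0)" for w
      using A(2) by (simp add: lookup_sum lookup_word_scale lookup_single when_def
          if_distrib[of "(*) _"] cong: if_cong)
    then have "Poly_Mapping.keys ?c \<subseteq> ?C"
      using A(1) by (auto simp: in_keys_iff split: if_splits)
    moreover have "cls ?c = cls 0"
      using A'(3) lincomb[OF A(2,1)] by (simp add: A(3) zero_UA)
    \<comment> \<open>Both \<open>?c\<close> and 0 are supported on canonical words and hence are
      their own normal forms.\<close>
    ultimately have "?c = 0"
      by (simp add: cls_eq_iff_normal_form normal_form_canonical)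
    moreover obtain w where "w \<in> A" "v = ?wc w"
      using A'(4) A(3) by blast
    ultimately show False
      using lookup[of w] A'(5) by simp
  qed
  moreover have "carrier UA \<subseteq> V.span (?wc ` ?C)"
  proof
    fix u assume "u \<in> carrier UA"
    then obtain p where u: "u = cls p"
      by (auto simp: carrier_UA)
    let ?c = "normal_form p"
    define a where "a = (\<lambda>x. Poly_Mapping.lookup ?c (the_inv_into ?C ?wc x))"
    have a: "a (?wc w) = Poly_Mapping.lookup ?c w" if "w \<in> Poly_Mapping.keys ?c" for w
      using that keys_normal_form[of p] by (auto simp: a_def the_inv_into_f_f[OF inj_on_word_class])
    have "V.lincomb a (?wc ` Poly_Mapping.keys ?c) = cls (\<Sum>w\<in>Poly_Mapping.keys ?c. word_scale (Poly_Mapping.lookup ?c w) (mon w))"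
      by (simp add: lincomb keys_normal_form a)
    also have "\<dots> = u"
      by (simp add: u cls_eq_iff_normal_form normal_form_canonical keys_normal_form
          flip: poly_mapping_eq_sum_mon)
    finally show "u \<in> V.span (?wc ` ?C)"
      unfolding V.span_def using keys_normal_form[of p] by (force intro!: exI[of _ a])
  qed
  moreover have "?wc ` ?C \<subseteq> carrier UA"
    by (auto simp: word_class_eq cls_closed)
  moreover from this have "V.span (?wc ` ?C) \<subseteq> carrier UA"
    by (rule V.span_is_subset2)
  ultimately show ?thesis
    unfolding V.basis_def by blast
qed

end

theorem mainTheorem1:
  fixes scale :: "'k::field \<Rightarrow> 'g::ab_group_add \<Rightarrow> 'g"
    and bracket :: "'g \<Rightarrow> 'g \<Rightarrow> 'g"
    and B :: "'g set"
    and r :: "'g rel"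
  assumes "lie_algebra scale bracket"
    and "\<not> Modules.module.dependent scale B"
    and "Modules.module.span scale B = UNIV"
    and "linear_order_on B r"
  shows "(\<forall>u \<in> carrier (enveloping_algebra scale bracket).
            \<exists>!c :: 'g list \<Rightarrow>\<^sub>0 'k. Poly_Mapping.keys c \<subseteq> canonical_words B r \<and>
              u = finsum (enveloping_algebra scale bracket)
                    (\<lambda>w. Poly_Mapping.lookup c w \<odot>\<^bsub>enveloping_algebra scale bracket\<^esub> word_class scale bracket w)
                    (Poly_Mapping.keys c)) \<and>
         vectorspace class_ring (enveloping_algebra scale bracket) \<and>
         inj_on (word_class scale bracket) (canonical_words B r) \<and>
         vectorspace.basis class_ring (enveloping_algebra scale bracket)
           (word_class scale bracket ` canonical_words B r)"
proof -
  interpret lie_algebra scale bracket by fact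
  interpret pbw scale bracket B r
    by unfold_locales fact+
  show ?thesis
    using ex1_canonical vectorspace_UA inj_on_word_class basis_word_class by blast
qed

end
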